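(* Let $l:[0,T]\to\mathbb R\cup\{\infty\}$ be a continuous function with $l(0)\neq0$, and let $a\in\mathbb R\setminus\{0\}$. Then there exist $\tau>0$ and a curve $\gamma:(0,\tau)\to(\mathbb H,0,\infty)$ such that $LC_\gamma(t)=l(t)$ for $t\in(0,\tau)$ and $\gamma$ has scale $a$ at $0$.
   Context: $\mathbb H$ is the upper half-plane; $\mathbb R\cup\{\infty\}$ carries its one-point compactification topology. $\gamma:(0,\tau)\to(\mathbb H,0,\infty)$ means $\gamma[0,\tau)$ is a simple curve with $\gamma(0,\tau)\subset\mathbb H$, $\gamma(0)=0$. Loewner framework: with $\gamma$ parametrized by halfplane capacity, $g_t:\mathbb H\setminus\gamma(0,t]\to\mathbb H$ is conformal with $g_t(z)=z+\frac{2t}{z}+O(1/z^2)$ at $\infty$ and solves $\partial_tg_t(z)=2/(g_t(z)-\lambda(t))$, $g_0(z)=z$, where $\lambda(t)=g_t(\gamma(t))$ is the driving function; $\gamma$ is generated by $\lambda$. Loewner curvature (in this halfplane-capacity setting): $LC_\gamma(t)=\lambda'(t)^3/\lambda''(t)$, with $0/0:=0$ and $x/0:=\infty$ for $x\ne0$. Scale: if $\gamma$ has driving function $\lambda\in C^2[0,\tau)$ with $\lambda'(0)\neq0$, the scale of $\gamma$ at $0$ is $\frac23\lambda'(0)$ (the coefficient of $t$ in the expansion $\gamma(t)=2i\sqrt t+\frac23\lambda'(0)t+O(t^{3/2})$). *)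

theory Defs
  imports "HOL-Analysis.Analysis"
begin

definition upper_half_plane :: "complex set" where
  "upper_half_plane = {z. Im z > 0}"

text \<open>The extended real line \<open>\<real> \<union> {\<infinity>}\<close> (one-point compactification) is modelled by
  \<open>real option\<close>, with \<open>None\<close> standing for \<open>\<infinity>\<close>.  Its topology is transported from the
  unit circle via the Cayley-type homeomorphism \<open>x \<mapsto> (x - i)/(x + i)\<close>, \<open>\<infinity> \<mapsto> 1\<close>.\<close>
definition ext_chart :: "real option \<Rightarrow> complex" where
  "ext_chart v = (case v of None \<Rightarrow> 1
                  | Some x \<Rightarrow> (complex_of_real x - \<i>) / (complex_of_real x + \<i>))"

definition ext_continuous_on :: "real set \<Rightarrow> (real \<Rightarrow> real option) \<Rightarrow> bool" where
  "ext_continuous_on S l \<longleftrightarrow> continuous_on S (ext_chart \<circ> l)"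

definition curve_H_0_inf :: "(real \<Rightarrow> complex) \<Rightarrow> real \<Rightarrow> bool" where
  "curve_H_0_inf \<gamma> \<tau> \<longleftrightarrow>
     continuous_on {0..<\<tau>} \<gamma> \<and> inj_on \<gamma> {0..<\<tau>} \<and> \<gamma> 0 = 0 \<and>
     \<gamma> ` {0<..<\<tau>} \<subseteq> upper_half_plane"

text \<open>Loewner framework: \<open>\<gamma>\<close> is parametrized by halfplane capacity and generated by the
  driving function \<open>\<lambda>\<close>.  The maps \<open>g t : \<bbbH> \<setminus> \<gamma>(0,t] \<rightarrow> \<bbbH>\<close> are conformal bijections with
  \<open>g t z = z + 2t/z + O(1/z^2)\<close> at \<open>\<infinity>\<close>, satisfy the Loewner equation with \<open>g 0 = id\<close>, and
  \<open>lam t = g t (\<gamma> t)\<close> (boundary value, as a limit from inside the domain).\<close>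
definition loewner_generated :: "(real \<Rightarrow> real) \<Rightarrow> (real \<Rightarrow> complex) \<Rightarrow> real \<Rightarrow> bool" where
  "loewner_generated lam \<gamma> \<tau> \<longleftrightarrow>
     curve_H_0_inf \<gamma> \<tau> \<and> continuous_on {0..<\<tau>} lam \<and>
     (\<exists>g :: real \<Rightarrow> complex \<Rightarrow> complex.
        (\<forall>z\<in>upper_half_plane. g 0 z = z) \<and>
        (\<forall>t\<in>{0..<\<tau>}.
           g t holomorphic_on (upper_half_plane - \<gamma> ` {0<..t}) \<and>
           bij_betw (g t) (upper_half_plane - \<gamma> ` {0<..t}) upper_half_plane \<and>
           (\<exists>C R. \<forall>z\<in>upper_half_plane. norm z > R \<longrightarrow>
               norm (g t z - z - 2 * complex_of_real t / z) \<le> C / (norm z)^2) \<and>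
           (\<forall>z\<in>upper_half_plane - \<gamma> ` {0<..t}.
               ((\<lambda>s. g s z) has_vector_derivative (2 / (g t z - complex_of_real (lam t))))
                 (at t within {0..<\<tau>})) \<and>
           ((g t) \<longlongrightarrow> complex_of_real (lam t)) (at (\<gamma> t) within (upper_half_plane - \<gamma> ` {0<..t}))))"

text \<open>Loewner curvature \<open>\<lambda>'^3/\<lambda>''\<close> with \<open>0/0 := 0\<close>, \<open>x/0 := \<infinity>\<close> (\<open>None\<close>) for \<open>x \<noteq> 0\<close>.\<close>
definition loewner_curvature_val :: "real \<Rightarrow> real \<Rightarrow> real option" where
  "loewner_curvature_val d1 d2 =
     (if d2 = 0 then (if d1 ^ 3 = 0 then Some 0 else None) else Some (d1 ^ 3 / d2))"

definition C2_derivs :: "(real \<Rightarrow> real) \<Rightarrow> (real \<Rightarrow> real) \<Rightarrow> (real \<Rightarrow> real) \<Rightarrow> real \<Rightarrow> bool" where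
  "C2_derivs lam lam1 lam2 \<tau> \<longleftrightarrow>
     (\<forall>t\<in>{0..<\<tau>}. (lam has_real_derivative lam1 t) (at t within {0..<\<tau>}) \<and>
                    (lam1 has_real_derivative lam2 t) (at t within {0..<\<tau>})) \<and>
     continuous_on {0..<\<tau>} lam2"

end

theory Submission
  imports Defs "HOL-Complex_Analysis.Complex_Analysis"
begin

text \<open>The curvature equation reads \<open>(\<lambda>'^(-2))' = - 2 / l\<close>, and \<open>1 / l\<close> is continuous near \<open>0\<close>, so it is
  solved by quadrature with \<open>\<lambda>' 0 = 3 a / 2\<close>. It remains to see that a driver with \<open>\<bar>\<lambda>'\<bar> \<le> M\<close> generates
  a simple curve up to time \<open>\<tau> \<le> 1 / M^2\<close>. Two solutions of \<open>x' = 2 / (x - \<lambda>)\<close> satisfy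
  \<open>x r - y r = (x s - y s) * exp (\<integral>_r^s 2 / ((x - \<lambda>) (y - \<lambda>)))\<close>, which yields uniqueness and holomorphic
  dependence on the end point. Solutions run backwards from \<open>\<lambda> t + \<i> \<epsilon>\<close> stay in the sector where
  \<open>Re ((x - \<lambda>)^2) \<le> 0\<close>, because \<open>(Re ((x - \<lambda>)^2))' = 4 - 2 \<lambda>' Re (x - \<lambda>) > 0\<close> for short times. There the
  exponent has nonpositive real part, so these solutions converge uniformly as \<open>\<epsilon> \<rightarrow> 0\<close>; the value of the
  limit at time \<open>0\<close> is \<open>\<gamma> t\<close>. The same contraction shows that every point swallowed at time \<open>t\<close>
  equals \<open>\<gamma> t\<close>.\<close>

section \<open>Ordinary differential equations on the line\<close>

lemma diff_le_of_deriv_le: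
  fixes f :: "real \<Rightarrow> real"
  assumes "a \<le> b"
    and f': "\<And>x. x \<in> {a..b} \<Longrightarrow> (f has_real_derivative f' x) (at x within {a..b})"
    and K: "\<And>x. x \<in> {a..b} \<Longrightarrow> f' x \<le> K"
  shows "f b - f a \<le> K * (b - a)"
proof (cases "a = b")
  case False
  then obtain x where "x \<in> {a<..<b}" "f b - f a = f' x * (b - a)"
    using mvt_simple[of a b f "\<lambda>x. (*) (f' x)"] f' \<open>a \<le> b\<close>
    by (auto simp: has_field_derivative_def)
  then show ?thesis
    using K[of x] \<open>a \<le> b\<close> by (auto intro!: mult_right_mono)
qed simp

lemma diff_ge_of_deriv_ge:
  fixes f :: "real \<Rightarrow> real"
  assumes "a \<le> b"
    and f': "\<And>x. x \<in> {a..b} \<Longrightarrow> (f has_real_derivative f' x) (at x within {a..b})"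
    and K: "\<And>x. x \<in> {a..b} \<Longrightarrow> f' x \<ge> K"
  shows "f b - f a \<ge> K * (b - a)"
proof -
  have "- f b - (- f a) \<le> - K * (b - a)"
    by (rule diff_le_of_deriv_le[where f' = "\<lambda>x. - f' x"])
      (use assms in \<open>auto intro!: derivative_eq_intros\<close>)
  then show ?thesis by simp
qed

lemma norm_diff_le_of_deriv_le:
  fixes f :: "real \<Rightarrow> 'a::real_normed_vector"
  assumes "a \<le> b"
    and f': "\<And>x. x \<in> {a..b} \<Longrightarrow> (f has_vector_derivative f' x) (at x within {a..b})"
    and K: "\<And>x. x \<in> {a..b} \<Longrightarrow> norm (f' x) \<le> K"
  shows "norm (f b - f a) \<le> K * (b - a)"
proof -
  have "norm (f b - f a) \<le> K * norm (b - a)"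
  proof (rule differentiable_bound[where S = "{a..b}"])
    show "\<And>x. x \<in> {a..b} \<Longrightarrow> (f has_derivative (\<lambda>h. h *\<^sub>R f' x)) (at x within {a..b})"
      using f' by (simp add: has_vector_derivative_def)
    show "onorm (\<lambda>h. h *\<^sub>R f' x) \<le> K" if "x \<in> {a..b}" for x
      using K[OF that] by (intro onorm_le) (simp add: mult.commute[of K] mult_left_mono)
  qed (use assms in auto)
  then show ?thesis using \<open>a \<le> b\<close> by simp
qed

text \<open>In the sup norm weighted by \<open>exp (- (2 * L * s))\<close> the Picard operator
  contracts by 1/2 whatever the length of the interval, so a single use of Banach's fixed point
  theorem covers all of \<open>{0..t}\<close>.\<close>

lemma picard_lindeloef:
  fixes f :: "real \<Rightarrow> 'a::banach \<Rightarrow> 'a" and t L :: real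
  assumes t: "0 \<le> t"
    and cont: "continuous_on ({0..t} \<times> UNIV) (\<lambda>p. f (fst p) (snd p))"
    and L: "0 < L" "\<And>s x y. s \<in> {0..t} \<Longrightarrow> norm (f s x - f s y) \<le> L * norm (x - y)"
  obtains x where "x 0 = w"
    "\<And>s. s \<in> {0..t} \<Longrightarrow> (x has_vector_derivative f s (x s)) (at s within {0..t})"
proof -
  \<comment> \<open>\<open>c\<close> clamps time to \<open>{0..t}\<close>; this turns functions on
    the interval into bounded continuous functions on the line, a complete space. The unknown
    \<open>q\<close> stands for \<open>exp (- (2 * L * s))\<close> times the solution.\<close>
  define c where "c u = max 0 (min t u)" for u :: real
  define e where "e q r = f r (exp (2 * L * r) *\<^sub>R apply_bcontfun q r)" for q r
  define H where "H q v = exp (- (2 * L * v)) *\<^sub>R (w + integral {0..v} (e q))" for q v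
  have e_cont: "continuous_on {0..t} (e q)" for q
    unfolding e_def
    by (rule continuous_on_compose2[OF cont,
        where f = "\<lambda>r. (r, exp (2 * L * r) *\<^sub>R apply_bcontfun q r)", simplified])
      (auto intro!: continuous_intros)
  have H_cont: "continuous_on {0..t} (H q)" for q
    unfolding H_def
    by (intro continuous_intros indefinite_integral_continuous_1 integrable_continuous_real e_cont)
  have c: "c u \<in> {0..t}" for u using t by (auto simp: c_def)
  have c_cont: "continuous_on UNIV c" unfolding c_def by (intro continuous_intros)
  have bc: "(\<lambda>u. H q (c u)) \<in> bcontfun" for q
    unfolding bcontfun_def
  proof (intro CollectI conjI)
    show "continuous_on UNIV (\<lambda>u. H q (c u))"
      by (rule continuous_on_compose2[OF H_cont c_cont]) (use c in auto)
    have "bounded (H q ` {0..t})"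
      by (intro compact_imp_bounded compact_continuous_image H_cont) simp
    then show "bounded (range (\<lambda>u. H q (c u)))"
      by (rule bounded_subset) (use c in auto)
  qed
  define A where "A q = Bcontfun (\<lambda>u. H q (c u))" for q
  have A: "apply_bcontfun (A q) u = H q (c u)" for q u
    unfolding A_def by (simp add: Bcontfun_inverse[OF bc])
  have "dist (A p) (A q) \<le> 1/2 * dist p q" for p q
  proof (rule dist_bound)
    fix u
    define v where "v = c u"
    have v: "0 \<le> v" "v \<le> t" using c[of u] by (auto simp: v_def)
    have sub: "{0..v} \<subseteq> {0..t}" using v by auto
    have int: "e q integrable_on {0..v}" for q
      by (rule integrable_continuous_real, rule continuous_on_subset[OF e_cont sub])
    \<comment> \<open>Integrating the weight gains a factor \<open>1 / (2 * L)\<close>, which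
      against the Lipschitz constant \<open>L\<close> leaves 1/2.\<close>
    have expint: "((\<lambda>r. (L * dist p q) * exp (2 * L * r)) has_integral
        (dist p q / 2 * exp (2 * L * v) - dist p q / 2 * exp (2 * L * 0))) {0..v}"
      by (rule fundamental_theorem_of_calculus)
        (use v L in \<open>auto intro!: derivative_eq_intros
           simp: has_real_derivative_iff_has_vector_derivative[symmetric] field_simps\<close>)
    have "norm (integral {0..v} (\<lambda>r. e p r - e q r))
        \<le> integral {0..v} (\<lambda>r. (L * dist p q) * exp (2 * L * r))"
    proof (rule integral_norm_bound_integral)
      show "(\<lambda>r. e p r - e q r) integrable_on {0..v}" by (intro integrable_diff int)
      show "(\<lambda>r. (L * dist p q) * exp (2 * L * r)) integrable_on {0..v}"
        using expint by blast
      fix r assume r: "r \<in> {0..v}"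
      have "norm (e p r - e q r) \<le> L * norm (exp (2 * L * r) *\<^sub>R (apply_bcontfun p r - apply_bcontfun q r))"
        using L(2)[of r "exp (2 * L * r) *\<^sub>R apply_bcontfun p r" "exp (2 * L * r) *\<^sub>R apply_bcontfun q r"] r v
        by (auto simp: e_def scaleR_diff_right)
      also have "\<dots> = (L * exp (2 * L * r)) * dist (apply_bcontfun p r) (apply_bcontfun q r)"
        by (simp add: dist_norm)
      also have "\<dots> \<le> (L * exp (2 * L * r)) * dist p q"
        using L(1) by (intro mult_left_mono dist_bounded) auto
      finally show "norm (e p r - e q r) \<le> (L * dist p q) * exp (2 * L * r)"
        by (simp add: mult_ac)
    qed
    also have "\<dots> = dist p q / 2 * (exp (2 * L * v) - 1)"
      using integral_unique[OF expint] by (simp add: algebra_simps)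
    finally have *: "norm (integral {0..v} (\<lambda>r. e p r - e q r)) \<le> dist p q / 2 * (exp (2 * L * v) - 1)" .
    have "dist (apply_bcontfun (A p) u) (apply_bcontfun (A q) u)
        = exp (- (2 * L * v)) * norm (integral {0..v} (\<lambda>r. e p r - e q r))"
      by (simp add: A dist_norm H_def v_def[symmetric] scaleR_diff_right[symmetric] integral_diff int)
    also have "\<dots> \<le> exp (- (2 * L * v)) * (dist p q / 2 * (exp (2 * L * v) - 1))"
      using * by (intro mult_left_mono) auto
    also have "\<dots> = dist p q / 2 * (1 - exp (- (2 * L * v)))"
      by (simp add: algebra_simps exp_minus)
    also have "\<dots> \<le> dist p q / 2 * 1" by (intro mult_left_mono) auto
    finally show "dist (apply_bcontfun (A p) u) (apply_bcontfun (A q) u) \<le> 1/2 * dist p q" by simp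
  qed
  then obtain q where q: "A q = q"
    using banach_fix_type[of "1/2" A] by auto
  define x where "x s = w + integral {0..s} (e q)" for s
  have eq: "e q s = f s (x s)" if "s \<in> {0..t}" for s
  proof -
    have "c s = s" using that by (auto simp: c_def)
    then have "apply_bcontfun q s = exp (- (2 * L * s)) *\<^sub>R x s"
      using A[of q s] by (simp add: q H_def x_def)
    then show ?thesis by (simp add: e_def mult_exp_exp)
  qed
  show ?thesis
  proof
    show "x 0 = w" by (simp add: x_def)
    fix s assume s: "s \<in> {0..t}"
    show "(x has_vector_derivative f s (x s)) (at s within {0..t})"
      using has_vector_derivative_add[OF has_vector_derivative_const
          integral_has_vector_derivative[OF e_cont s], of w q]
      by (simp add: eq[OF s, symmetric]) (simp add: x_def[abs_def])
  qed
qed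

section \<open>Trajectories of the Loewner flow\<close>

text \<open>\<open>small\<close> limits the time so that the motion of the driver cannot outweigh
  the repulsion term 4 in the derivative of \<open>Re ((x - lam)^2)\<close>.\<close>

locale slow_driver =
  fixes lam lam' :: "real \<Rightarrow> real" and \<tau> M :: real
  assumes tau_pos: "0 < \<tau>"
    and lam_deriv: "s \<in> {0..<\<tau>} \<Longrightarrow> (lam has_real_derivative lam' s) (at s within {0..<\<tau>})"
    and lam'_bound: "s \<in> {0..<\<tau>} \<Longrightarrow> \<bar>lam' s\<bar> \<le> M"
    and small: "M\<^sup>2 * \<tau> \<le> 1"
    and lam_0: "lam 0 = 0"
begin

text \<open>A Loewner trajectory still alive at time \<open>t\<close> itself. Positivity of
  \<open>Im (x s)\<close> keeps it off the real driver, so the quotient is never a division by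
  zero.\<close>

definition flow :: "real \<Rightarrow> (real \<Rightarrow> complex) \<Rightarrow> bool" where
  "flow t x \<longleftrightarrow> (\<forall>s\<in>{0..t}. 0 < Im (x s) \<and>
     (x has_vector_derivative 2 / (x s - of_real (lam s))) (at s within {0..t}))"

lemma M_nonneg: "0 \<le> M"
  using lam'_bound[of 0] tau_pos by auto

lemma lam_cont: "continuous_on {0..<\<tau>} lam"
  using lam_deriv by (meson DERIV_continuous continuous_on_eq_continuous_within)

lemma lam_cont_Icc: "t < \<tau> \<Longrightarrow> continuous_on {0..t} lam"
  by (rule continuous_on_subset[OF lam_cont]) auto

lemma lam_Lipschitz:
  assumes "0 \<le> s" "s \<le> t" "t < \<tau>"
  shows "\<bar>lam t - lam s\<bar> \<le> M * (t - s)"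
proof -
  have sub: "{s..t} \<subseteq> {0..<\<tau>}" using assms by auto
  have d: "(lam has_real_derivative lam' q) (at q within {s..t})" "\<bar>lam' q\<bar> \<le> M" if "q \<in> {s..t}" for q
    using DERIV_subset[OF lam_deriv[of q] sub] lam'_bound[of q] that assms by auto
  have "lam t - lam s \<le> M * (t - s)"
    by (rule diff_le_of_deriv_le[OF assms(2) d(1)]) (use d(2) in force)+
  moreover have "- M * (t - s) \<le> lam t - lam s"
    by (rule diff_ge_of_deriv_ge[OF assms(2) d(1)]) (use d(2) in force)+
  ultimately show ?thesis by simp
qed

lemma flow_Im_pos: "flow t x \<Longrightarrow> s \<in> {0..t} \<Longrightarrow> 0 < Im (x s)"
  by (simp add: flow_def)

lemma flow_deriv:
  assumes "flow t x" "s \<in> {a..b}" "0 \<le> a" "b \<le> t"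
  shows "(x has_vector_derivative 2 / (x s - of_real (lam s))) (at s within {a..b})"
  by (rule has_vector_derivative_within_subset[of _ _ _ "{0..t}"]) (use assms in \<open>auto simp: flow_def\<close>)

lemma flow_continuous: "flow t x \<Longrightarrow> continuous_on {0..t} x"
  unfolding flow_def by (meson continuous_on_eq_continuous_within has_vector_derivative_continuous)

lemma flow_restrict: "flow t x \<Longrightarrow> s \<le> t \<Longrightarrow> flow s x"
  using flow_deriv[of t x _ 0 s] flow_Im_pos[of t x] by (simp add: flow_def)

lemma norm_diff_driver_ge:
  "0 < Im z \<Longrightarrow> Im z \<le> cmod (z - of_real r)"
  using abs_Im_le_cmod[of "z - of_real r"] by simp

lemma diff_driver_nonzero: "0 < Im z \<Longrightarrow> z - of_real r \<noteq> 0"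
  using norm_diff_driver_ge[of z r] by fastforce

text \<open>The equation is solved backwards from \<open>w\<close>: in reversed time the imaginary
  part increases, so the solution stays at height at least \<open>Im w\<close>, where the field is
  Lipschitz.\<close>

lemma flow_exists:
  assumes t: "0 \<le> t" "t < \<tau>" and w: "0 < Im w"
  obtains x where "flow t x" "x t = w"
proof -
  define \<delta> where "\<delta> = Im w"
  have \<delta>: "\<delta> > 0" using w by (simp add: \<delta>_def)
  \<comment> \<open>\<open>p\<close> lifts every point to height at least \<open>\<delta>\<close>,
    which makes the truncated field Lipschitz on the whole plane; \<open>h_im\<close> shows
    afterwards that the solution never meets the truncation.\<close>
  define p where "p z = Complex (Re z) (max \<delta> (Im z))" for z
  have p_im: "Im (p z) \<ge> \<delta>" for z by (simp add: p_def)
  define d where "d u z = p z - of_real (lam (t - u))" for u z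
  have d_ge: "cmod (d u z) \<ge> \<delta>" for u z
    using norm_diff_driver_ge[of "p z" "lam (t - u)"] p_im[of z] \<delta> by (simp add: d_def)
  have d_ne: "d u z \<noteq> 0" for u z using d_ge[of u z] \<delta> by auto
  have d_diff: "cmod (d u a - d u b) \<le> cmod (a - b)" for u a b
  proof -
    have "\<bar>max \<delta> (Im a) - max \<delta> (Im b)\<bar> \<le> \<bar>Im (a - b)\<bar>" by auto
    then have "(max \<delta> (Im a) - max \<delta> (Im b))\<^sup>2 \<le> (Im (a - b))\<^sup>2"
      using abs_le_square_iff by blast
    then show ?thesis
      by (simp add: d_def p_def cmod_def)
  qed
  \<comment> \<open>The minus sign comes from the time reversal \<open>u = t - s\<close>.\<close>
  define f where "f u z = - 2 / d u z" for u z
  have p_cont: "continuous_on UNIV p"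
    unfolding p_def complex_eq[of "Complex _ _", simplified] by (intro continuous_intros)
  obtain h where h0: "h 0 = w" and h: "\<And>u. u \<in> {0..t} \<Longrightarrow>
      (h has_vector_derivative f u (h u)) (at u within {0..t})"
  proof (rule picard_lindeloef[of t f "2 / \<delta>\<^sup>2"])
    show "continuous_on ({0..t} \<times> UNIV) (\<lambda>p. f (fst p) (snd p))"
      unfolding f_def
    proof (intro continuous_intros)
      show "continuous_on ({0..t} \<times> UNIV) (\<lambda>z. d (fst z) (snd z))"
        unfolding d_def
        by (intro continuous_intros continuous_on_compose2[OF p_cont] 
            continuous_on_compose2[OF lam_cont_Icc[OF t(2)]]) auto
    qed (use d_ne in auto)
    fix u a b assume "u \<in> {0..t}"
    have "f u a - f u b = 2 * (d u a - d u b) / (d u a * d u b)"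
      using d_ne by (simp add: f_def field_simps)
    then have "cmod (f u a - f u b) = 2 * cmod (d u a - d u b) / (cmod (d u a) * cmod (d u b))"
      by (simp only: norm_mult norm_divide) simp
    also have "\<dots> \<le> 2 * cmod (a - b) / (\<delta> * \<delta>)"
      using d_ge d_diff \<delta> by (intro frac_le mult_mono) auto
    finally show "cmod (f u a - f u b) \<le> 2 / \<delta>\<^sup>2 * cmod (a - b)"
      by (simp add: power2_eq_square)
  qed (use t \<delta> in auto)
  have h_im: "Im (h u) \<ge> \<delta>" if "u \<in> {0..t}" for u
  proof -
    have "0 * (u - 0) \<le> Im (h u) - Im (h 0)"
    proof (rule diff_ge_of_deriv_ge[where f' = "\<lambda>u. Im (f u (h u))"])
      fix v assume v: "v \<in> {0..u}"
      have "(h has_vector_derivative f v (h v)) (at v within {0..u})"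
        by (rule has_vector_derivative_within_subset[OF h]) (use v that in auto)
      then show "((\<lambda>v. Im (h v)) has_real_derivative Im (f v (h v))) (at v within {0..u})"
        by (rule has_field_derivative_Im)
      have "Im (d v (h v)) \<ge> 0" using p_im[of "h v"] \<delta> by (simp add: d_def)
      then show "Im (f v (h v)) \<ge> 0"
        by (simp add: f_def Im_divide)
    qed (use that in auto)
    then show ?thesis by (simp add: h0 \<delta>_def)
  qed
  define x where "x s = h (t - s)" for s
  have "flow t x"
    unfolding flow_def
  proof (intro ballI conjI)
    fix s assume s: "s \<in> {0..t}"
    then have ts: "t - s \<in> {0..t}" by auto
    show pos: "0 < Im (x s)" using h_im[OF ts] \<delta> by (simp add: x_def)
    have "p (x s) = x s" using h_im[OF ts] by (simp add: p_def x_def complex_eq_iff)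
    then have "f (t - s) (h (t - s)) = - (2 / (x s - of_real (lam s)))"
      by (simp add: f_def d_def x_def)
    moreover have "((\<lambda>s. t - s) has_vector_derivative -1) (at s within {0..t})"
      by (auto intro!: derivative_eq_intros)
    moreover have "(h has_vector_derivative f (t - s) (h (t - s))) (at (t - s) within (\<lambda>s. t - s) ` {0..t})"
      by (rule has_vector_derivative_within_subset[OF h[OF ts]]) auto
    ultimately show "(x has_vector_derivative 2 / (x s - of_real (lam s))) (at s within {0..t})"
      using vector_diff_chain_within[of "\<lambda>s. t - s" "-1" s "{0..t}" h "f (t - s) (h (t - s))"]
      by (simp add: x_def[abs_def] o_def)
  qed
  then show ?thesis using that[of x] h0 by (simp add: x_def)
qed


section \<open>Real and imaginary parts along a trajectory\<close>

lemma flow_Re_deriv: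
  assumes "flow t x" "t < \<tau>" "s \<in> {a..b}" "0 \<le> a" "b \<le> t"
  shows "((\<lambda>s. Re (x s) - lam s) has_real_derivative
      2 * (Re (x s) - lam s) / (cmod (x s - of_real (lam s)))\<^sup>2 - lam' s) (at s within {a..b})"
proof -
  have "((\<lambda>s. Re (x s)) has_real_derivative Re (2 / (x s - of_real (lam s)))) (at s within {a..b})"
    by (rule has_field_derivative_Re[OF flow_deriv[OF assms(1,3,4,5)]])
  moreover have "(lam has_real_derivative lam' s) (at s within {a..b})"
    by (rule DERIV_subset[OF lam_deriv]) (use assms in auto)
  ultimately show ?thesis
    by (rule DERIV_cong[OF DERIV_diff]) (simp add: Re_divide cmod_def)
qed

lemma flow_Im_deriv:
  assumes "flow t x" "s \<in> {a..b}" "0 \<le> a" "b \<le> t"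
  shows "((\<lambda>s. Im (x s)) has_real_derivative
      - (2 * Im (x s) / (cmod (x s - of_real (lam s)))\<^sup>2)) (at s within {a..b})"
  using has_field_derivative_Im[OF flow_deriv[OF assms]]
  by (simp add: Im_divide cmod_def)

lemma flow_Im_antimono:
  assumes "flow t x" "0 \<le> r" "r \<le> s" "s \<le> t"
  shows "Im (x s) \<le> Im (x r)"
proof -
  have "Im (x s) - Im (x r) \<le> 0 * (s - r)"
    by (rule diff_le_of_deriv_le[OF _ flow_Im_deriv[OF assms(1)]])
      (use assms flow_Im_pos[OF assms(1)] in \<open>auto simp: less_imp_le\<close>)
  then show ?thesis by simp
qed

text \<open>The derivative of \<open>(Im x)^2\<close> is -4 times the ratio of
  \<open>(Im x)^2\<close> to the squared distance from the driver, and this ratio is at most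
  1.\<close>

lemma flow_Im_square_le:
  assumes "flow t x" "0 \<le> r" "r \<le> s" "s \<le> t"
  shows "(Im (x r))\<^sup>2 \<le> (Im (x s))\<^sup>2 + 4 * (s - r)"
proof -
  have "- 4 * (s - r) \<le> (Im (x s))\<^sup>2 - (Im (x r))\<^sup>2"
  proof (rule diff_ge_of_deriv_ge)
    fix q assume q: "q \<in> {r..s}"
    show "((\<lambda>s. (Im (x s))\<^sup>2) has_real_derivative
        - (4 * ((Im (x q))\<^sup>2 / (cmod (x q - of_real (lam q)))\<^sup>2))) (at q within {r..s})"
      by (rule DERIV_cong[OF DERIV_power[OF flow_Im_deriv[OF assms(1) q]]])
        (use assms in \<open>auto simp: power2_eq_square\<close>)
    have "0 < Im (x q)" using flow_Im_pos[OF assms(1)] q assms by auto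
    then have "(Im (x q))\<^sup>2 / (cmod (x q - of_real (lam q)))\<^sup>2 \<le> 1"
      using norm_diff_driver_ge by (auto simp: divide_le_eq_1 intro!: power_mono)
    then show "- 4 \<le> - (4 * ((Im (x q))\<^sup>2 / (cmod (x q - of_real (lam q)))\<^sup>2))" by linarith
  qed (use assms in auto)
  then show ?thesis by simp
qed

text \<open>\<open>sqrt (X^2 + k^2)\<close> is a differentiable substitute for
  \<open>\<bar>X\<bar>\<close>, at most \<open>k\<close> above it. Its derivative splits into a
  repulsion term between 0 and \<open>2 / k\<close> and a drift term of size at most
  \<open>M\<close>.\<close>

lemma smooth_abs_deriv:
  assumes "flow t x" "t < \<tau>" "q \<in> {a..b}" "0 \<le> a" "b \<le> t" "0 < k"
  defines "X \<equiv> \<lambda>s. Re (x s) - lam s"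
  defines "N \<equiv> (cmod (x q - of_real (lam q)))\<^sup>2"
  shows "((\<lambda>s. sqrt ((X s)\<^sup>2 + k\<^sup>2)) has_real_derivative
      2 * ((X q)\<^sup>2 / N / sqrt ((X q)\<^sup>2 + k\<^sup>2)) - lam' q * (X q / sqrt ((X q)\<^sup>2 + k\<^sup>2)))
      (at q within {a..b})"
    and "0 \<le> (X q)\<^sup>2 / N / sqrt ((X q)\<^sup>2 + k\<^sup>2)"
    and "(X q)\<^sup>2 / N / sqrt ((X q)\<^sup>2 + k\<^sup>2) \<le> 1 / k"
    and "\<bar>lam' q * (X q / sqrt ((X q)\<^sup>2 + k\<^sup>2))\<bar> \<le> M"
proof -
  have pos: "0 < (X q)\<^sup>2 + k\<^sup>2" using assms(6) by (simp add: add_nonneg_pos)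
  have k: "k \<le> sqrt ((X q)\<^sup>2 + k\<^sup>2)" by (rule real_le_rsqrt) simp
  have X: "\<bar>X q\<bar> \<le> sqrt ((X q)\<^sup>2 + k\<^sup>2)" by (rule real_le_rsqrt) simp
  have N: "N = (X q)\<^sup>2 + (Im (x q))\<^sup>2"
    by (simp add: N_def X_def cmod_power2)
  have "0 < Im (x q)" using flow_Im_pos[OF assms(1)] assms(3-5) by auto
  then have "N > 0" unfolding N by (intro add_nonneg_pos) auto
  then have N1: "(X q)\<^sup>2 / N \<le> 1" by (simp add: N)
  have dX: "(X has_real_derivative 2 * X q / N - lam' q) (at q within {a..b})"
    unfolding X_def N_def by (rule flow_Re_deriv[OF assms(1-5)])
  show "((\<lambda>s. sqrt ((X s)\<^sup>2 + k\<^sup>2)) has_real_derivative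
      2 * ((X q)\<^sup>2 / N / sqrt ((X q)\<^sup>2 + k\<^sup>2)) - lam' q * (X q / sqrt ((X q)\<^sup>2 + k\<^sup>2)))
      (at q within {a..b})"
  proof (rule DERIV_cong)
    show "((\<lambda>s. sqrt ((X s)\<^sup>2 + k\<^sup>2)) has_real_derivative
        inverse (sqrt ((X q)\<^sup>2 + k\<^sup>2)) / 2 * (2 * X q * (2 * X q / N - lam' q))) (at q within {a..b})"
    proof (rule DERIV_chain'[where f = "\<lambda>s. (X s)\<^sup>2 + k\<^sup>2" and g = sqrt])
      show "((\<lambda>s. (X s)\<^sup>2 + k\<^sup>2) has_real_derivative 2 * X q * (2 * X q / N - lam' q)) (at q within {a..b})"
        using DERIV_add[OF DERIV_power[OF dX, of 2] DERIV_const[of "k\<^sup>2"]] by (simp add: mult_ac)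
      show "(sqrt has_real_derivative inverse (sqrt ((X q)\<^sup>2 + k\<^sup>2)) / 2) (at ((X q)\<^sup>2 + k\<^sup>2))"
        by (rule DERIV_real_sqrt[OF pos])
    qed
    have "inverse S / 2 * (2 * y * (2 * y / N - c)) = 2 * (y\<^sup>2 / N / S) - c * (y / S)" for S y c :: real
      by (cases "S = 0"; cases "N = 0") (simp_all add: field_simps power2_eq_square)
    then show "inverse (sqrt ((X q)\<^sup>2 + k\<^sup>2)) / 2 * (2 * X q * (2 * X q / N - lam' q)) =
        2 * ((X q)\<^sup>2 / N / sqrt ((X q)\<^sup>2 + k\<^sup>2)) - lam' q * (X q / sqrt ((X q)\<^sup>2 + k\<^sup>2))" .
  qed
  show "0 \<le> (X q)\<^sup>2 / N / sqrt ((X q)\<^sup>2 + k\<^sup>2)" by (simp add: N)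
  show "(X q)\<^sup>2 / N / sqrt ((X q)\<^sup>2 + k\<^sup>2) \<le> 1 / k"
    using N1 k assms(6) by (intro frac_le) auto
  have "\<bar>lam' q\<bar> * \<bar>X q / sqrt ((X q)\<^sup>2 + k\<^sup>2)\<bar> \<le> M * 1"
    using lam'_bound[of q] X pos assms(2-5) M_nonneg
    by (intro mult_mono) (auto simp: divide_le_eq_1)
  then show "\<bar>lam' q * (X q / sqrt ((X q)\<^sup>2 + k\<^sup>2))\<bar> \<le> M" by (simp add: abs_mult)
qed

lemma flow_Re_backward:
  assumes "flow t x" "t < \<tau>" "0 \<le> r" "r \<le> s" "s \<le> t"
  shows "\<bar>Re (x r) - lam r\<bar> \<le> \<bar>Re (x s) - lam s\<bar> + M * (s - r)"
proof (rule field_le_epsilon)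
  fix k :: real assume k: "0 < k"
  let ?X = "\<lambda>s. Re (x s) - lam s"
  have "- M * (s - r) \<le> sqrt ((?X s)\<^sup>2 + k\<^sup>2) - sqrt ((?X r)\<^sup>2 + k\<^sup>2)"
  proof (rule diff_ge_of_deriv_ge[where f' = "\<lambda>q. 2 * ((?X q)\<^sup>2 / (cmod (x q - of_real (lam q)))\<^sup>2 / sqrt ((?X q)\<^sup>2 + k\<^sup>2)) - lam' q * (?X q / sqrt ((?X q)\<^sup>2 + k\<^sup>2))"])
    fix q assume q: "q \<in> {r..s}"
    note S = smooth_abs_deriv[OF assms(1,2) q assms(3,5) k]
    show "((\<lambda>s. sqrt ((?X s)\<^sup>2 + k\<^sup>2)) has_real_derivative 2 * ((?X q)\<^sup>2 / (cmod (x q - of_real (lam q)))\<^sup>2 / sqrt ((?X q)\<^sup>2 + k\<^sup>2)) - lam' q * (?X q / sqrt ((?X q)\<^sup>2 + k\<^sup>2))) (at q within {r..s})"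
      by (fact S(1))
    show "- M \<le> 2 * ((?X q)\<^sup>2 / (cmod (x q - of_real (lam q)))\<^sup>2 / sqrt ((?X q)\<^sup>2 + k\<^sup>2)) - lam' q * (?X q / sqrt ((?X q)\<^sup>2 + k\<^sup>2))" using S(2-4) by linarith
  qed (fact assms)
  moreover have "\<bar>?X r\<bar> \<le> sqrt ((?X r)\<^sup>2 + k\<^sup>2)" by (rule real_le_rsqrt) simp
  moreover have "sqrt ((?X s)\<^sup>2 + k\<^sup>2) \<le> \<bar>?X s\<bar> + k"
    using k sqrt_sum_squares_le_sum_abs[of "?X s" k] by simp
  ultimately show "\<bar>?X r\<bar> \<le> \<bar>?X s\<bar> + M * (s - r) + k" by linarith
qed

text \<open>Forwards in time the repulsion counts against the bound and costs up to
  \<open>2 / k\<close>. The parameter \<open>k\<close> stays free so that it can be balanced against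
  the elapsed time.\<close>

lemma flow_Re_forward:
  assumes "flow t x" "t < \<tau>" "0 \<le> r" "r \<le> s" "s \<le> t" and k: "0 < k"
  shows "\<bar>Re (x s) - lam s\<bar> \<le> \<bar>Re (x r) - lam r\<bar> + k + (2 / k + M) * (s - r)"
proof -
  let ?X = "\<lambda>s. Re (x s) - lam s"
  have "sqrt ((?X s)\<^sup>2 + k\<^sup>2) - sqrt ((?X r)\<^sup>2 + k\<^sup>2) \<le> (2 / k + M) * (s - r)"
  proof (rule diff_le_of_deriv_le[where f' = "\<lambda>q. 2 * ((?X q)\<^sup>2 / (cmod (x q - of_real (lam q)))\<^sup>2 / sqrt ((?X q)\<^sup>2 + k\<^sup>2)) - lam' q * (?X q / sqrt ((?X q)\<^sup>2 + k\<^sup>2))"])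
    fix q assume q: "q \<in> {r..s}"
    note S = smooth_abs_deriv[OF assms(1,2) q assms(3,5) k]
    show "((\<lambda>s. sqrt ((?X s)\<^sup>2 + k\<^sup>2)) has_real_derivative 2 * ((?X q)\<^sup>2 / (cmod (x q - of_real (lam q)))\<^sup>2 / sqrt ((?X q)\<^sup>2 + k\<^sup>2)) - lam' q * (?X q / sqrt ((?X q)\<^sup>2 + k\<^sup>2))) (at q within {r..s})"
      by (fact S(1))
    show "2 * ((?X q)\<^sup>2 / (cmod (x q - of_real (lam q)))\<^sup>2 / sqrt ((?X q)\<^sup>2 + k\<^sup>2)) - lam' q * (?X q / sqrt ((?X q)\<^sup>2 + k\<^sup>2)) \<le> 2 / k + M"
      using S(2-4) times_divide_eq_right[of 2 1 k] by linarith
  qed (fact assms)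
  moreover have "\<bar>?X s\<bar> \<le> sqrt ((?X s)\<^sup>2 + k\<^sup>2)" by (rule real_le_rsqrt) simp
  moreover have "sqrt ((?X r)\<^sup>2 + k\<^sup>2) \<le> \<bar>?X r\<bar> + k"
    using k sqrt_sum_squares_le_sum_abs[of "?X r" k] by simp
  ultimately show ?thesis by linarith
qed

text \<open>The quantity bounded here is the real part of \<open>(x - \<lambda>)\<^sup>2\<close>; where it is nonpositive,
  \<open>x - \<lambda>\<close> lies in the sector \<open>\<bar>Re\<bar> \<le> Im\<close>.\<close>
lemma flow_Re_square_backward:
  assumes "flow t x" "t < \<tau>" "0 \<le> r" "r \<le> s" "s \<le> t"
    and X: "M * \<bar>Re (x s) - lam s\<bar> \<le> 1/2"
  shows "(Re (x r) - lam r)\<^sup>2 - (Im (x r))\<^sup>2 \<le> (Re (x s) - lam s)\<^sup>2 - (Im (x s))\<^sup>2 - (s - r)"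
proof -
  let ?X = "\<lambda>s. Re (x s) - lam s"
  have "1 * (s - r) \<le> ((?X s)\<^sup>2 - (Im (x s))\<^sup>2) - ((?X r)\<^sup>2 - (Im (x r))\<^sup>2)"
  proof (rule diff_ge_of_deriv_ge)
    fix q assume q: "q \<in> {r..s}"
    let ?N = "(cmod (x q - of_real (lam q)))\<^sup>2"
    have "0 < Im (x q)" using flow_Im_pos[OF assms(1)] q assms by auto
    then have N: "?N = (?X q)\<^sup>2 + (Im (x q))\<^sup>2" "?N > 0"
      by (auto simp: cmod_power2 add_nonneg_pos)
    note D = DERIV_diff[OF DERIV_power[OF flow_Re_deriv[OF assms(1,2) q assms(3,5)], of 2] 
        DERIV_power[OF flow_Im_deriv[OF assms(1) q assms(3,5)], of 2]]
    show "((\<lambda>s. (?X s)\<^sup>2 - (Im (x s))\<^sup>2) has_real_derivative 4 - 2 * (lam' q * ?X q))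
        (at q within {r..s})"
    proof (rule DERIV_cong[OF D])
      have "4 * (?X q)\<^sup>2 / ?N + 4 * (Im (x q))\<^sup>2 / ?N = 4"
        using N(2) unfolding add_divide_distrib[symmetric] by (subst divide_eq_eq) (auto simp: N(1))
      then show "real 2 * ((2 * ?X q / ?N - lam' q) * ?X q ^ (2 - Suc 0)) -
          real 2 * (- (2 * Im (x q) / ?N) * Im (x q) ^ (2 - Suc 0)) = 4 - 2 * (lam' q * ?X q)"
        by (simp add: algebra_simps power2_eq_square)
    qed
    \<comment> \<open>The hypothesis on \<open>x s\<close> and \<open>small\<close> bound this
      product by 1/2 + 1, so the derivative is at least 4 - 3 = 1.\<close>
    have "\<bar>lam' q * ?X q\<bar> \<le> M * (\<bar>?X s\<bar> + M * (s - q))"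
      unfolding abs_mult using lam'_bound[of q] q assms M_nonneg flow_Re_backward[OF assms(1,2), of q s]
      by (intro mult_mono) auto
    also have "\<dots> = M * \<bar>?X s\<bar> + M\<^sup>2 * (s - q)" by (simp add: algebra_simps power2_eq_square)
    also have "\<dots> \<le> 1/2 + M\<^sup>2 * \<tau>"
      using X q assms by (intro add_mono mult_left_mono) auto
    finally show "1 \<le> 4 - 2 * (lam' q * ?X q)" using small by linarith
  qed (use assms in auto)
  then show ?thesis by simp
qed


section \<open>Holomorphic dependence on the end point\<close>

text \<open>The negated divided difference of the Loewner field at two trajectories:
  \<open>(x - y)' = - kern x y * (x - y)\<close>.\<close>

definition kern :: "(real \<Rightarrow> complex) \<Rightarrow> (real \<Rightarrow> complex) \<Rightarrow> real \<Rightarrow> complex" where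
  "kern x y q = 2 / ((x q - of_real (lam q)) * (y q - of_real (lam q)))"

lemma kern_continuous:
  assumes "flow t x" "flow t y" "t < \<tau>"
  shows "continuous_on {0..t} (kern x y)"
  unfolding kern_def
proof (intro continuous_intros flow_continuous[OF assms(1)] flow_continuous[OF assms(2)]
      lam_cont_Icc assms ballI)
  fix q assume "q \<in> {0..t}"
  then show "(x q - of_real (lam q)) * (y q - of_real (lam q)) \<noteq> 0"
    using diff_driver_nonzero[OF flow_Im_pos[OF assms(1)], of q "lam q"]
      diff_driver_nonzero[OF flow_Im_pos[OF assms(2)], of q "lam q"]
    by (metis mult_eq_0_iff)
qed

lemma flow_diff:
  assumes x: "flow t x" and y: "flow t y" and t: "t < \<tau>" and rs: "0 \<le> r" "r \<le> s" "s \<le> t"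
  shows "x r - y r = (x s - y s) * exp (integral {r..s} (kern x y))"
proof -
  have c: "continuous_on {r..s} (kern x y)"
    by (rule continuous_on_subset[OF kern_continuous[OF x y t]]) (use rs in auto)
  \<comment> \<open>The difference times its integrating factor, hence constant.\<close>
  define \<phi> where "\<phi> q = (x q - y q) * exp (integral {r..q} (kern x y))" for q
  have "(\<phi> has_vector_derivative 0) (at q within {r..s})" if q: "q \<in> {r..s}" for q
  proof -
    have E: "((\<lambda>q. exp (integral {r..q} (kern x y))) has_vector_derivative
        kern x y q * exp (integral {r..q} (kern x y))) (at q within {r..s})"
      using field_vector_diff_chain_within[OF integral_has_vector_derivative[OF c q], of exp]
      by (simp add: o_def DERIV_exp has_field_derivative_at_within)
    have ne: "x q - of_real (lam q) \<noteq> 0" "y q - of_real (lam q) \<noteq> 0"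
      using flow_Im_pos[OF x, of q] flow_Im_pos[OF y, of q] q rs by (auto dest!: diff_driver_nonzero)
    have d: "2 / (x q - of_real (lam q)) - 2 / (y q - of_real (lam q)) = - (kern x y q * (x q - y q))"
      using ne by (simp add: kern_def divide_simps)
    have "((\<lambda>q. x q - y q) has_vector_derivative - (kern x y q * (x q - y q))) (at q within {r..s})"
      unfolding d[symmetric] 
      by (intro has_vector_derivative_diff flow_deriv[OF x] flow_deriv[OF y]) (use q rs in auto)
    from has_vector_derivative_mult[OF this E] show ?thesis
      by (simp add: \<phi>_def[abs_def] algebra_simps)
  qed
  then obtain k where k: "\<And>q. q \<in> {r..s} \<Longrightarrow> \<phi> q = k"
    using has_vector_derivative_zero_constant[of "{r..s}" \<phi>] by auto
  have "\<phi> r = \<phi> s" using k[of r] k[of s] rs by auto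
  then show ?thesis by (simp add: \<phi>_def)
qed

text \<open>The modulus of the exponential sees only the real part of the exponent, so a sign of
  \<open>Re (kern x y q)\<close> is enough for contraction.\<close>

lemma flow_diff_norm:
  assumes x: "flow t x" and y: "flow t y" and t: "t < \<tau>" and rs: "0 \<le> r" "r \<le> s" "s \<le> t"
    and K: "\<And>q. q \<in> {r..s} \<Longrightarrow> Re (kern x y q) \<le> K"
  shows "cmod (x r - y r) \<le> cmod (x s - y s) * exp (K * (s - r))"
proof -
  have c: "continuous_on {r..s} (kern x y)"
    by (rule continuous_on_subset[OF kern_continuous[OF x y t]]) (use rs in auto)
  then have int: "kern x y integrable_on {r..s}" by (rule integrable_continuous_real)
  have "Re (integral {r..s} (kern x y)) = integral {r..s} (\<lambda>q. Re (kern x y q))"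
    using integral_linear[OF int bounded_linear_Re] by (simp add: o_def)
  also have "\<dots> \<le> integral {r..s} (\<lambda>q. K)"
    using integrable_linear[OF int bounded_linear_Re] by (intro integral_le K) (auto simp: o_def)
  finally have "Re (integral {r..s} (kern x y)) \<le> K * (s - r)" using rs by (simp add: mult.commute)
  then show ?thesis
    unfolding flow_diff[OF x y t rs] norm_mult by (intro mult_left_mono) auto
qed

lemma kern_norm_le:
  assumes "\<delta> > 0" "\<epsilon> > 0" "\<delta> \<le> cmod (x q - of_real (lam q))" "\<epsilon> \<le> cmod (y q - of_real (lam q))"
  shows "cmod (kern x y q) \<le> 2 / (\<delta> * \<epsilon>)"
  unfolding kern_def norm_divide norm_mult
  using assms by (intro frac_le mult_mono mult_pos_pos) auto

text \<open>Imaginary parts grow backwards, so a height bound at the later time controls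
  \<open>kern\<close> at all earlier ones. The generous \<open>\<tau>\<close> in the exponent makes
  the constant independent of the times.\<close>

lemma flow_diff_norm_Im:
  assumes x: "flow t x" and y: "flow t y" and t: "t < \<tau>" and rs: "0 \<le> r" "r \<le> s" "s \<le> t"
    and \<delta>: "\<delta> > 0" "\<delta> \<le> Im (x s)" "\<delta> \<le> Im (y s)"
  shows "cmod (x r - y r) \<le> cmod (x s - y s) * exp (2 / (\<delta> * \<delta>) * \<tau>)"
proof -
  have "cmod (x r - y r) \<le> cmod (x s - y s) * exp (2 / (\<delta> * \<delta>) * (s - r))"
  proof (rule flow_diff_norm[OF x y t rs])
    fix q assume q: "q \<in> {r..s}"
    have "\<delta> \<le> cmod (z q - of_real (lam q))" if z: "flow t z" "\<delta> \<le> Im (z s)" for z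
      using flow_Im_antimono[OF z(1), of q s] z(2) q rs flow_Im_pos[OF z(1), of q]
        norm_diff_driver_ge[of "z q" "lam q"] by auto
    from kern_norm_le[where x = x and y = y, OF \<delta>(1,1) this[OF x \<delta>(2)] this[OF y \<delta>(3)]]
    show "Re (kern x y q) \<le> 2 / (\<delta> * \<delta>)"
      using complex_Re_le_cmod order_trans by blast
  qed
  also have "\<dots> \<le> cmod (x s - y s) * exp (2 / (\<delta> * \<delta>) * \<tau>)"
    using rs t \<delta> by (intro mult_left_mono) (auto intro!: divide_right_mono)
  finally show ?thesis .
qed

text \<open>The exponential factor in \<open>flow_diff\<close> never vanishes, so agreement at one
  time spreads in both directions.\<close>

lemma flow_unique:
  assumes x: "flow t x" and y: "flow t y" and t: "t < \<tau>" and rs: "r \<in> {0..t}" "s \<in> {0..t}"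
    and eq: "x r = y r"
  shows "x s = y s"
proof (cases "s \<le> r")
  case True
  then show ?thesis using flow_diff[OF x y t, of s r] rs eq by auto
next
  case False
  then show ?thesis using flow_diff[OF x y t, of r s] rs eq by auto
qed

text \<open>\<open>tr t w\<close> is the trajectory that is at \<open>w\<close> at time \<open>t\<close>, so \<open>\<lambda>w. tr t w 0\<close> is
  the inverse of the Loewner map at time \<open>t\<close> and \<open>D t\<close> is the complement of the hull.\<close>
definition tr :: "real \<Rightarrow> complex \<Rightarrow> real \<Rightarrow> complex" where
  "tr t w = (SOME x. flow t x \<and> x t = w)"

definition D :: "real \<Rightarrow> complex set" where
  "D t = (\<lambda>w. tr t w 0) ` {w. Im w > 0}"

lemma tr:
  assumes "0 \<le> t" "t < \<tau>" "0 < Im w"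
  shows "flow t (tr t w)" "tr t w t = w"
proof -
  have "\<exists>x. flow t x \<and> x t = w" using flow_exists[OF assms] by metis
  then have "flow t (tr t w) \<and> tr t w t = w" unfolding tr_def by (rule someI_ex)
  then show "flow t (tr t w)" "tr t w t = w" by auto
qed

lemma tr_eq:
  assumes "flow t x" "0 \<le> t" "t < \<tau>" "s \<in> {0..t}"
  shows "tr t (x t) s = x s"
  using flow_unique[OF tr(1) assms(1,3), of "x t" t s] tr(2)[of t "x t"]
    flow_Im_pos[OF assms(1), of t] assms by auto

lemma D_iff:
  assumes "0 \<le> t" "t < \<tau>"
  shows "z \<in> D t \<longleftrightarrow> (\<exists>x. flow t x \<and> x 0 = z)"
proof
  assume "z \<in> D t"
  then show "\<exists>x. flow t x \<and> x 0 = z" using tr(1)[OF assms] by (auto simp: D_def)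
next
  assume "\<exists>x. flow t x \<and> x 0 = z"
  then obtain x where x: "flow t x" "x 0 = z" by auto
  then have "z = tr t (x t) 0" "Im (x t) > 0"
    using tr_eq[OF x(1) assms, of 0] flow_Im_pos[OF x(1), of t] assms by auto
  then show "z \<in> D t" by (auto simp: D_def)
qed

lemma D_subset: "0 \<le> s \<Longrightarrow> s \<le> t \<Longrightarrow> t < \<tau> \<Longrightarrow> D t \<subseteq> D s"
  using D_iff[of s] D_iff[of t] flow_restrict[of t _ s] by fastforce

lemma D_Im_pos: "0 \<le> t \<Longrightarrow> t < \<tau> \<Longrightarrow> z \<in> D t \<Longrightarrow> Im z > 0"
  using D_iff[of t z] by (auto dest: flow_Im_pos[where s = 0])

lemma D_0: "D 0 = {z. Im z > 0}"
  using tr(2)[of 0] tau_pos by (force simp: D_def)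

lemma tr_inj: "0 \<le> t \<Longrightarrow> t < \<tau> \<Longrightarrow> inj_on (\<lambda>w. tr t w 0) {w. Im w > 0}"
proof (rule inj_onI)
  fix v w assume t: "0 \<le> t" "t < \<tau>" and vw: "v \<in> {w. Im w > 0}" "w \<in> {w. Im w > 0}" "tr t v 0 = tr t w 0"
  then show "v = w"
    using flow_unique[OF tr(1)[OF t, of v] tr(1)[OF t, of w] t(2), of 0 t] tr(2)[OF t] by auto
qed

lemma tr_Lipschitz:
  assumes "0 \<le> t" "t < \<tau>" "0 \<le> s" "s \<le> t" "\<delta> > 0" "\<delta> \<le> Im v" "\<delta> \<le> Im w"
  shows "cmod (tr t v s - tr t w s) \<le> cmod (v - w) * exp (2 / (\<delta> * \<delta>) * \<tau>)"
  using flow_diff_norm_Im[OF tr(1) tr(1) \<open>t < \<tau>\<close>, of v w s t \<delta>] assms tr(2)[of t v] tr(2)[of t w]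
  by auto

lemma tr_tendsto:
  assumes t: "0 \<le> t" "t < \<tau>" "0 \<le> s" "s \<le> t" and w: "Im w > 0"
  shows "((\<lambda>v. tr t v s) \<longlongrightarrow> tr t w s) (at w)"
proof (rule LIM_zero_cancel, rule Lim_null_comparison)
  have "eventually (\<lambda>v. v \<in> {v. Im v > Im w / 2}) (at w)"
    using w by (intro eventually_at_in_open' open_halfspace_Im_gt) auto
  then show "\<forall>\<^sub>F v in at w. cmod (tr t v s - tr t w s)
      \<le> cmod (v - w) * exp (2 / (Im w / 2 * (Im w / 2)) * \<tau>)"
  proof eventually_elim
    case (elim v)
    then show ?case using tr_Lipschitz[OF t, of "Im w / 2" v w] w by auto
  qed
  show "((\<lambda>v. cmod (v - w) * exp (2 / (Im w / 2 * (Im w / 2)) * \<tau>)) \<longlongrightarrow> 0) (at w)"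
    by (auto intro!: tendsto_eq_intros)
qed

text \<open>By \<open>flow_diff\<close> the difference quotient at \<open>w\<close> is exactly the
  exponential of an integral of \<open>kern\<close>, so the derivative is obtained by letting both
  trajectories coincide in the exponent.\<close>

lemma tr_holomorphic:
  assumes t: "0 \<le> t" "t < \<tau>"
  shows "(\<lambda>w. tr t w 0) holomorphic_on {w. Im w > 0}"
proof -
  have op: "open {w. Im w > 0}" by (rule open_halfspace_Im_gt)
  have "((\<lambda>w. tr t w 0) has_field_derivative exp (integral {0..t} (kern (tr t w) (tr t w)))) (at w)"
    if w: "Im w > 0" for w
  proof -
    \<comment> \<open>Half the height of \<open>w\<close> is a common lower bound for the heights of
      all nearby end points, and then of their whole trajectories.\<close>
    define \<delta> where "\<delta> = Im w / 2"
    have \<delta>: "\<delta> > 0" "\<delta> \<le> Im w" using w by (auto simp: \<delta>_def)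
    define C where "C = 2 / (\<delta> * \<delta> * \<delta>) * exp (2 / (\<delta> * \<delta>) * \<tau>)"
    have near: "eventually (\<lambda>v. v \<in> {v. Im v > \<delta>}) (at w)"
      using w by (intro eventually_at_in_open' open_halfspace_Im_gt) (auto simp: \<delta>_def)
    have ge: "\<delta> \<le> cmod (tr t v q - of_real (lam q))" if "Im v \<ge> \<delta>" "q \<in> {0..t}" for v q
    proof -
      have v: "Im v > 0" using that \<delta> by auto
      note f = tr[OF t v]
      show ?thesis
        using flow_Im_antimono[OF f(1), of q t] f(2) that t flow_Im_pos[OF f(1), of q]
          norm_diff_driver_ge[of "tr t v q" "lam q"] by auto
    qed
    \<comment> \<open>Lipschitz dependence of \<open>kern\<close> on the end point, uniform in time,
      allows the limit to pass under the integral.\<close>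
    have kd: "cmod (kern (tr t v) (tr t w) q - kern (tr t w) (tr t w) q) \<le> C * cmod (v - w)"
      if v: "Im v > \<delta>" and q: "q \<in> {0..t}" for v q
    proof -
      let ?a = "tr t v q - of_real (lam q)" and ?b = "tr t w q - of_real (lam q)"
      have a: "\<delta> \<le> cmod ?a" and b: "\<delta> \<le> cmod ?b" using ge[of v q] ge[of w q] v q \<delta> by auto
      then have ne: "?a \<noteq> 0" "?b \<noteq> 0" using \<delta> by auto
      have "kern (tr t v) (tr t w) q - kern (tr t w) (tr t w) q = 2 * (?b - ?a) / (?a * ?b * ?b)"
        unfolding kern_def using ne by (simp add: divide_simps)
      also have "cmod \<dots> = 2 * cmod (tr t v q - tr t w q) / (cmod ?a * cmod ?b * cmod ?b)"
        by (simp only: norm_mult norm_divide) (simp add: norm_minus_commute)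
      also have "\<dots> \<le> 2 * (cmod (v - w) * exp (2 / (\<delta> * \<delta>) * \<tau>)) / (\<delta> * \<delta> * \<delta>)"
        using a b \<delta> v q tr_Lipschitz[OF t, of q \<delta> v w]
        by (intro frac_le mult_mono mult_pos_pos) auto
      finally show ?thesis by (simp add: C_def mult_ac)
    qed
    have int: "kern (tr t v) (tr t w) integrable_on {0..t}" if "Im v > 0" for v
      by (rule integrable_continuous_real[OF kern_continuous[OF tr(1)[OF t that] tr(1)[OF t w] t(2)]])
    have "((\<lambda>v. integral {0..t} (kern (tr t v) (tr t w))) \<longlongrightarrow> integral {0..t} (kern (tr t w) (tr t w))) (at w)"
    proof (rule LIM_zero_cancel, rule Lim_null_comparison)
      show "\<forall>\<^sub>F v in at w. cmod (integral {0..t} (kern (tr t v) (tr t w)) - integral {0..t} (kern (tr t w) (tr t w)))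
          \<le> C * cmod (v - w) * t"
        using near
      proof eventually_elim
        case (elim v)
        then have v: "Im v > 0" using \<delta> by auto
        have "cmod (integral {0..t} (\<lambda>q. kern (tr t v) (tr t w) q - kern (tr t w) (tr t w) q))
            \<le> integral {0..t} (\<lambda>q. C * cmod (v - w))"
          by (rule integral_norm_bound_integral)
            (use kd elim int[OF v] int[OF w] in \<open>auto intro!: integrable_diff\<close>)
        then show ?case using t int[OF v] int[OF w] by (simp add: integral_diff mult_ac)
      qed
      show "((\<lambda>v. C * cmod (v - w) * t) \<longlongrightarrow> 0) (at w)"
        by (auto intro!: tendsto_eq_intros)
    qed
    then have "((\<lambda>v. exp (integral {0..t} (kern (tr t v) (tr t w)))) \<longlongrightarrow>
        exp (integral {0..t} (kern (tr t w) (tr t w)))) (at w)"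
      by (rule tendsto_exp)
    then have "((\<lambda>v. (tr t v 0 - tr t w 0) / (v - w)) \<longlongrightarrow>
        exp (integral {0..t} (kern (tr t w) (tr t w)))) (at w)"
    proof (rule Lim_transform_eventually)
      show "\<forall>\<^sub>F v in at w. exp (integral {0..t} (kern (tr t v) (tr t w))) = (tr t v 0 - tr t w 0) / (v - w)"
        using near eventually_neq_at_within[of w w UNIV]
      proof eventually_elim
        case (elim v)
        then have v: "Im v > 0" using \<delta> by auto
        show ?case
          using flow_diff[OF tr(1)[OF t v] tr(1)[OF t w] t(2), of 0 t] t elim
          by (simp add: tr(2)[OF t v] tr(2)[OF t w])
      qed
    qed
    then show ?thesis by (simp add: has_field_derivative_iff)
  qed
  then show ?thesis
    using op by (auto simp: holomorphic_on_open)
qed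

lemma D_open: "0 \<le> t \<Longrightarrow> t < \<tau> \<Longrightarrow> open (D t)"
  unfolding D_def
  by (rule open_mapping_thm3[OF tr_holomorphic open_halfspace_Im_gt tr_inj])


lemma flow_cong:
  assumes "flow t x" "\<And>s. s \<in> {0..t} \<Longrightarrow> y s = x s"
  shows "flow t y"
  unfolding flow_def
proof (intro ballI conjI)
  fix s assume s: "s \<in> {0..t}"
  show "0 < Im (y s)" using flow_Im_pos[OF assms(1) s] assms(2)[OF s] by simp
  have "(x has_vector_derivative 2 / (y s - of_real (lam s))) (at s within {0..t})"
    using flow_deriv[OF assms(1) s] assms(2)[OF s] by simp
  then show "(y has_vector_derivative 2 / (y s - of_real (lam s))) (at s within {0..t})"
    by (rule has_vector_derivative_transform[OF s assms(2), rotated])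
qed

section \<open>Displacement of one trajectory and contraction of two\<close>

lemma flow_displacement:
  assumes x: "flow t x" and rs: "0 \<le> r" "r \<le> s" "s \<le> t" and \<delta>: "\<delta> > 0"
    and far: "\<And>q. q \<in> {r..s} \<Longrightarrow> \<delta> \<le> cmod (x q - of_real (lam q))"
  shows "cmod (x s - x r) \<le> 2 / \<delta> * (s - r)"
proof (rule norm_diff_le_of_deriv_le[OF rs(2)])
  fix q assume q: "q \<in> {r..s}"
  show "(x has_vector_derivative 2 / (x q - of_real (lam q))) (at q within {r..s})"
    by (rule flow_deriv[OF x q rs(1,3)])
  show "cmod (2 / (x q - of_real (lam q))) \<le> 2 / \<delta>"
    using far[OF q] \<delta> by (simp add: norm_divide frac_le)
qed

lemma flow_displacement_Im:
  assumes x: "flow t x" and rs: "0 \<le> r" "r \<le> s" "s \<le> t" and \<delta>: "\<delta> > 0" "\<delta> \<le> Im (x s)"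
  shows "cmod (x s - x r) \<le> 2 / \<delta> * (s - r)"
proof (rule flow_displacement[OF x rs \<delta>(1)])
  fix q assume q: "q \<in> {r..s}"
  show "\<delta> \<le> cmod (x q - of_real (lam q))"
    using flow_Im_antimono[OF x, of q s] flow_Im_pos[OF x, of q] q rs \<delta>
      norm_diff_driver_ge[of "x q" "lam q"] by auto
qed

text \<open>Nonzero points of the sector have arguments between \<pi>/4 and 3\<pi>/4, so a product
  of two points lies in the closed left half-plane, and so does its reciprocal.\<close>

lemma Re_inverse_sector:
  assumes "(Re a)\<^sup>2 \<le> (Im a)\<^sup>2" "(Re b)\<^sup>2 \<le> (Im b)\<^sup>2" "0 \<le> Im a" "0 \<le> Im b"
  shows "Re (2 / (a * b)) \<le> 0"
proof -
  have "\<bar>Re a\<bar> \<le> Im a" "\<bar>Re b\<bar> \<le> Im b" using assms by (auto intro: abs_le_square_iff[THEN iffD2, of "Re a" "Im a"] simp: abs_le_square_iff[symmetric])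
  then have "\<bar>Re a\<bar> * \<bar>Re b\<bar> \<le> Im a * Im b" by (intro mult_mono) auto
  then have "Re a * Re b \<le> Im a * Im b" by (metis abs_le_D1 abs_mult)
  then have "Re (a * b) \<le> 0" by simp
  then show ?thesis by (simp only: Re_divide) (auto intro!: divide_nonpos_nonneg)
qed

lemma flow_diff_sector:
  assumes x: "flow t x" and y: "flow t y" and t: "t < \<tau>" and rs: "0 \<le> r" "r \<le> s" "s \<le> t"
    and "\<And>q. q \<in> {r..s} \<Longrightarrow> (Re (x q) - lam q)\<^sup>2 \<le> (Im (x q))\<^sup>2"
    and "\<And>q. q \<in> {r..s} \<Longrightarrow> (Re (y q) - lam q)\<^sup>2 \<le> (Im (y q))\<^sup>2"
  shows "cmod (x r - y r) \<le> cmod (x s - y s)"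
proof -
  have "cmod (x r - y r) \<le> cmod (x s - y s) * exp (0 * (s - r))"
  proof (rule flow_diff_norm[OF x y t rs])
    fix q assume q: "q \<in> {r..s}"
    show "Re (kern x y q) \<le> 0"
      unfolding kern_def
      by (rule Re_inverse_sector) (use assms q flow_Im_pos[OF x, of q] flow_Im_pos[OF y, of q] in auto)
  qed
  then show ?thesis by simp
qed

section \<open>The tip of the curve\<close>

text \<open>At time 0 this is the preimage of \<open>lam t + \<i> * \<epsilon>\<close> under the
  Loewner map at time \<open>t\<close>; letting \<open>\<epsilon>\<close> tend to 0 descends to the
  tip.\<close>

definition approach :: "real \<Rightarrow> real \<Rightarrow> real \<Rightarrow> complex" where
  "approach t \<epsilon> = tr t (Complex (lam t) \<epsilon>)"

lemma approach_flow:
  assumes "0 \<le> t" "t < \<tau>" "\<epsilon> > 0"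
  shows "flow t (approach t \<epsilon>)" "approach t \<epsilon> t = Complex (lam t) \<epsilon>"
  using tr[of t "Complex (lam t) \<epsilon>"] assms by (auto simp: approach_def)

text \<open>At time \<open>t\<close> the real offset from the driver is 0, so the backward estimates
  for trajectories apply with the best possible start.\<close>

lemma approach_bounds:
  assumes "0 \<le> t" "t < \<tau>" "\<epsilon> > 0" "s \<in> {0..t}"
  shows "(Re (approach t \<epsilon> s) - lam s)\<^sup>2 - (Im (approach t \<epsilon> s))\<^sup>2 \<le> - (t - s)"
    and "\<bar>Re (approach t \<epsilon> s) - lam s\<bar> \<le> M * (t - s)"
    and "(Im (approach t \<epsilon> s))\<^sup>2 \<le> \<epsilon>\<^sup>2 + 4 * (t - s)"
    and "0 < Im (approach t \<epsilon> s)"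
proof -
  note f = approach_flow[OF assms(1-3)]
  show "(Re (approach t \<epsilon> s) - lam s)\<^sup>2 - (Im (approach t \<epsilon> s))\<^sup>2 \<le> - (t - s)"
  proof -
    have "(Re (approach t \<epsilon> s) - lam s)\<^sup>2 - (Im (approach t \<epsilon> s))\<^sup>2 \<le> - \<epsilon>\<^sup>2 - (t - s)"
      using flow_Re_square_backward[OF f(1) assms(2), of s t] assms(4) f(2) by simp
    then show ?thesis using zero_le_power2[of \<epsilon>] by linarith
  qed
  show "\<bar>Re (approach t \<epsilon> s) - lam s\<bar> \<le> M * (t - s)"
    using flow_Re_backward[OF f(1) assms(2), of s t] assms(4) f(2) by auto
  show "(Im (approach t \<epsilon> s))\<^sup>2 \<le> \<epsilon>\<^sup>2 + 4 * (t - s)"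
    using flow_Im_square_le[OF f(1), of s t] assms(4) f(2) by auto
  show "0 < Im (approach t \<epsilon> s)" using flow_Im_pos[OF f(1) assms(4)] .
qed

text \<open>Both trajectories stay in the sector, where going backwards does not increase their
  distance. The bound is uniform in \<open>t\<close> and \<open>s\<close>, which later carries
  continuity over to the limit.\<close>

lemma approach_diff:
  assumes "0 \<le> t" "t < \<tau>" "\<epsilon> > 0" "\<epsilon>' > 0" "s \<in> {0..t}"
  shows "cmod (approach t \<epsilon> s - approach t \<epsilon>' s) \<le> \<bar>\<epsilon> - \<epsilon>'\<bar>"
proof -
  note f = approach_flow[OF assms(1-3)] and f' = approach_flow[OF assms(1,2,4)]
  have sector: "(Re (approach t e q) - lam q)\<^sup>2 \<le> (Im (approach t e q))\<^sup>2"
    if "e > 0" "q \<in> {s..t}" for e q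
    using approach_bounds(1)[OF assms(1,2) that(1), of q] that(2) assms(5) by auto
  have "cmod (approach t \<epsilon> s - approach t \<epsilon>' s) \<le> cmod (approach t \<epsilon> t - approach t \<epsilon>' t)"
    by (rule flow_diff_sector[OF f(1) f'(1) assms(2)])
      (use assms(3-5) sector in auto)
  also have "\<dots> = \<bar>\<epsilon> - \<epsilon>'\<bar>"
    by (simp add: f(2) f'(2) cmod_def)
  finally show ?thesis .
qed

text \<open>The limit is taken at every time \<open>s\<close>, not only at 0, so that it can be
  shown to be a trajectory itself before time \<open>t\<close>.\<close>

definition tip :: "real \<Rightarrow> real \<Rightarrow> complex" where
  "tip t s = lim (\<lambda>n. approach t (1 / real (Suc n)) s)"

lemma tip_LIMSEQ:
  assumes "0 \<le> t" "t < \<tau>" "s \<in> {0..t}"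
  shows "(\<lambda>n. approach t (1 / real (Suc n)) s) \<longlonglongrightarrow> tip t s"
proof -
  have "Cauchy (\<lambda>n. 1 / real (Suc n))"
    using LIMSEQ_Suc[OF lim_1_over_n[where 'a = real]] by (auto intro: LIMSEQ_imp_Cauchy)
  then have "Cauchy (\<lambda>n. approach t (1 / real (Suc n)) s)"
    unfolding Cauchy_def dist_norm real_norm_def
    using approach_diff[OF assms(1,2) _ _ assms(3)]
    by (meson divide_pos_pos of_nat_0_less_iff order_le_less_trans zero_less_Suc zero_less_one)
  then show ?thesis
    unfolding tip_def using Cauchy_convergent convergent_LIMSEQ_iff by blast
qed

lemma tip_approach:
  assumes "0 \<le> t" "t < \<tau>" "\<epsilon> > 0" "s \<in> {0..t}"
  shows "cmod (tip t s - approach t \<epsilon> s) \<le> \<epsilon>"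
proof (rule LIMSEQ_le)
  show "(\<lambda>n. cmod (approach t (1 / real (Suc n)) s - approach t \<epsilon> s)) \<longlonglongrightarrow> cmod (tip t s - approach t \<epsilon> s)"
    by (intro tendsto_intros tip_LIMSEQ assms)
  have "(\<lambda>n. \<bar>1 / real (Suc n) - \<epsilon>\<bar>) \<longlonglongrightarrow> \<bar>0 - \<epsilon>\<bar>"
    by (intro tendsto_intros LIMSEQ_Suc[OF lim_1_over_n[where 'a = real]])
  then show "(\<lambda>n. \<bar>1 / real (Suc n) - \<epsilon>\<bar>) \<longlonglongrightarrow> \<epsilon>"
    using assms(3) by simp
  show "\<exists>N. \<forall>n\<ge>N. cmod (approach t (1 / real (Suc n)) s - approach t \<epsilon> s) \<le> \<bar>1 / real (Suc n) - \<epsilon>\<bar>"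
    using approach_diff[OF assms(1,2) _ assms(3,4)] by simp
qed

text \<open>The weak inequalities for \<open>approach\<close> survive the limit, and the term
  \<open>\<epsilon>^2\<close> in the height bound disappears.\<close>

lemma tip_bounds:
  assumes t: "0 \<le> t" "t < \<tau>" "s \<in> {0..t}"
  shows "(Re (tip t s) - lam s)\<^sup>2 - (Im (tip t s))\<^sup>2 \<le> - (t - s)"
    and "\<bar>Re (tip t s) - lam s\<bar> \<le> M * (t - s)"
    and "Im (tip t s) \<le> 2 * sqrt (t - s)"
    and "0 \<le> Im (tip t s)"
proof -
  note L = tip_LIMSEQ[OF t]
  have p: "1 / real (Suc n) > 0" for n by simp
  note B = approach_bounds[OF t(1,2) p t(3)]
  show "(Re (tip t s) - lam s)\<^sup>2 - (Im (tip t s))\<^sup>2 \<le> - (t - s)"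
    by (rule LIMSEQ_le_const2[of "\<lambda>n. (Re (approach t (1 / real (Suc n)) s) - lam s)\<^sup>2 - (Im (approach t (1 / real (Suc n)) s))\<^sup>2"])
      (use B(1) in \<open>auto intro!: tendsto_intros L simp del: of_nat_Suc\<close>)
  show "\<bar>Re (tip t s) - lam s\<bar> \<le> M * (t - s)"
    by (rule LIMSEQ_le_const2[of "\<lambda>n. \<bar>Re (approach t (1 / real (Suc n)) s) - lam s\<bar>"])
      (use B(2) in \<open>auto intro!: tendsto_intros L simp del: of_nat_Suc\<close>)
  show "0 \<le> Im (tip t s)"
    by (rule LIMSEQ_le_const[of "\<lambda>n. Im (approach t (1 / real (Suc n)) s)"])
      (use B(4) in \<open>auto intro!: tendsto_intros L less_imp_le simp del: of_nat_Suc\<close>)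
  have "(Im (tip t s))\<^sup>2 \<le> 0\<^sup>2 + 4 * (t - s)"
  proof (rule LIMSEQ_le)
    show "(\<lambda>n. (Im (approach t (1 / real (Suc n)) s))\<^sup>2) \<longlonglongrightarrow> (Im (tip t s))\<^sup>2"
      by (intro tendsto_intros L)
    show "(\<lambda>n. (1 / real (Suc n))\<^sup>2 + 4 * (t - s)) \<longlonglongrightarrow> 0\<^sup>2 + 4 * (t - s)"
      by (intro tendsto_intros LIMSEQ_Suc[OF lim_1_over_n[where 'a = real]])
  qed (use B(3) in blast)
  then have "Im (tip t s) \<le> sqrt (4 * (t - s))" by (intro real_le_rsqrt) simp
  then show "Im (tip t s) \<le> 2 * sqrt (t - s)" by (simp only: real_sqrt_mult real_sqrt_four)
qed

text \<open>The gain \<open>t - s\<close> in the sector inequality is strictly positive before time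
  \<open>t\<close>; it keeps the limit off the real axis.\<close>

lemma tip_Im_pos:
  assumes "0 \<le> s" "s < t" "t < \<tau>"
  shows "0 < Im (tip t s)"
proof -
  have "(Re (tip t s) - lam s)\<^sup>2 < (Im (tip t s))\<^sup>2" "0 \<le> Im (tip t s)"
    using tip_bounds(1,4)[of t s] assms by auto
  then have "Im (tip t s) \<noteq> 0" using zero_le_power2[of "Re (tip t s) - lam s"] by auto
  then show ?thesis using \<open>0 \<le> Im (tip t s)\<close> by simp
qed

text \<open>At time \<open>s\<close> the limit point is still in the half-plane, where trajectories
  depend continuously on their end point. Hence the limit of the approximating trajectories is the
  trajectory through the limit point.\<close>

lemma tip_flow:
  assumes "0 \<le> s" "s < t" "t < \<tau>"
  shows "flow s (tip t)"
proof (rule flow_cong[OF tr(1)])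
  show "0 < Im (tip t s)" by (rule tip_Im_pos[OF assms])
  fix r assume r: "r \<in> {0..s}"
  have p: "1 / real (Suc n) > 0" for n by simp
  have "(\<lambda>n. tr s (approach t (1 / real (Suc n)) s) r) \<longlonglongrightarrow> tr s (tip t s) r"
  proof (rule isCont_tendsto_compose[where g = "\<lambda>v. tr s v r"])
    show "isCont (\<lambda>v. tr s v r) (tip t s)"
      unfolding isCont_def using tr_tendsto[of s r "tip t s"] assms r tip_Im_pos[OF assms] by auto
    show "(\<lambda>n. approach t (1 / real (Suc n)) s) \<longlonglongrightarrow> tip t s"
      using tip_LIMSEQ[of t s] assms by auto
  qed
  moreover have "tr s (approach t (1 / real (Suc n)) s) r = approach t (1 / real (Suc n)) r" for n
    using tr_eq[OF flow_restrict[OF approach_flow(1)[OF _ assms(3) p]], of s r n] assms r by auto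
  moreover have "(\<lambda>n. approach t (1 / real (Suc n)) r) \<longlonglongrightarrow> tip t r"
    using tip_LIMSEQ[of t r] assms r by auto
  ultimately show "tip t r = tr s (tip t s) r"
    using LIMSEQ_unique by fastforce
qed (use assms in auto)

definition curve :: "real \<Rightarrow> complex" where
  "curve t = tip t 0"

lemma curve_0: "curve 0 = 0"
  using tip_bounds(2,3,4)[of 0 0] tau_pos by (simp add: curve_def complex_eq_iff lam_0)

text \<open>If \<open>curve t\<close> survived until \<open>t\<close>, uniqueness would identify its
  trajectory with \<open>tip t\<close> before \<open>t\<close>. The height of the former stays
  bounded below, that of the latter tends to 0.\<close>

lemma curve_in_D_iff:
  assumes "0 \<le> t" "t < \<tau>" "0 \<le> s" "s < \<tau>"
  shows "curve t \<in> D s \<longleftrightarrow> s < t"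
proof
  assume "s < t"
  then show "curve t \<in> D s"
    using D_iff[of s "curve t"] tip_flow[of s t] assms by (auto simp: curve_def)
next
  assume inD: "curve t \<in> D s"
  show "s < t"
  proof (rule ccontr)
    assume "\<not> s < t"
    then have "curve t \<in> D t" using D_subset[of t s] inD assms by auto
    then obtain x where x: "flow t x" "x 0 = curve t" using D_iff assms by auto
    have c: "Im (x t) > 0" using flow_Im_pos[OF x(1), of t] assms by auto
    \<comment> \<open>Chosen so that \<open>2 * sqrt (t - r)\<close> is at most half of
      \<open>Im (x t)\<close>.\<close>
    define r where "r = max 0 (t - (Im (x t) / 4)\<^sup>2)"
    show False
    proof (cases "t = 0")
      case True
      then show False using c x(2) curve_0 by simp
    next
      case False
      then have r: "0 \<le> r" "r < t" using c assms by (auto simp: r_def)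
      have "x r = tip t r"
        by (rule flow_unique[OF flow_restrict[OF x(1)] tip_flow, of r t 0]) (use r assms x(2) in \<open>auto simp: curve_def\<close>)
      moreover have "Im (x t) \<le> Im (x r)" using flow_Im_antimono[OF x(1), of r t] r by auto
      moreover have "sqrt (t - r) \<le> Im (x t) / 4"
        by (rule real_le_lsqrt) (use r c in \<open>auto simp: r_def\<close>)
      moreover have "Im (tip t r) \<le> 2 * sqrt (t - r)" using tip_bounds(3)[of t r] r assms by auto
      ultimately show False using c by simp
    qed
  qed
qed

lemma curve_Im_pos: "0 < t \<Longrightarrow> t < \<tau> \<Longrightarrow> 0 < Im (curve t)"
  using tip_Im_pos[of 0 t] by (simp add: curve_def)

text \<open>For s < t the set \<open>D s\<close> contains \<open>curve t\<close> but not
  \<open>curve s\<close>.\<close>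

lemma curve_inj: "inj_on curve {0..<\<tau>}"
  using curve_in_D_iff
  by (intro inj_onI) (metis atLeastLessThan_iff less_irrefl linorder_neqE_linordered_idom)

text \<open>Both trajectories are compared at the earlier time \<open>t\<close>: the driver has
  moved by at most \<open>M * (t' - t)\<close>, the trajectory from \<open>t'\<close> by at most
  \<open>2 / \<epsilon> * (t' - t)\<close>, and both points have height at least
  \<open>\<epsilon>\<close>.\<close>

lemma approach_Lipschitz:
  assumes "0 \<le> t" "t \<le> t'" "t' < \<tau>" "\<epsilon> > 0"
  shows "cmod (approach t \<epsilon> 0 - approach t' \<epsilon> 0) \<le> (2 / \<epsilon> + M) * exp (2 / (\<epsilon> * \<epsilon>) * \<tau>) * (t' - t)"
proof -
  have t': "0 \<le> t'" using assms by simp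
  note f = approach_flow[OF t' assms(3,4)]
  define v where "v = approach t' \<epsilon> t"
  have v: "\<epsilon> \<le> Im v" using flow_Im_antimono[OF f(1) assms(1,2) order_refl] by (simp add: v_def f(2))
  have "cmod (Complex (lam t) \<epsilon> - Complex (lam t') \<epsilon>) \<le> M * (t' - t)"
    using lam_Lipschitz[OF assms(1-3)] by (simp add: cmod_def abs_minus_commute)
  moreover have "cmod (Complex (lam t') \<epsilon> - v) \<le> 2 / \<epsilon> * (t' - t)"
    using flow_displacement_Im[OF f(1) assms(1,2) order_refl assms(4)] by (simp add: f(2) v_def)
  ultimately have d: "cmod (Complex (lam t) \<epsilon> - v) \<le> (2 / \<epsilon> + M) * (t' - t)"
    using norm_triangle_ineq[of "Complex (lam t) \<epsilon> - Complex (lam t') \<epsilon>" "Complex (lam t') \<epsilon> - v"]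
    by (simp add: distrib_right)
  have "tr t v 0 = approach t' \<epsilon> 0"
    unfolding v_def by (rule tr_eq[OF flow_restrict[OF f(1)]]) (use assms in auto)
  then have "cmod (approach t \<epsilon> 0 - approach t' \<epsilon> 0) \<le> cmod (Complex (lam t) \<epsilon> - v) * exp (2 / (\<epsilon> * \<epsilon>) * \<tau>)"
    using tr_Lipschitz[of t 0 \<epsilon> "Complex (lam t) \<epsilon>" v] v assms by (simp add: approach_def)
  also have "\<dots> \<le> ((2 / \<epsilon> + M) * (t' - t)) * exp (2 / (\<epsilon> * \<epsilon>) * \<tau>)"
    using d by (rule mult_right_mono) simp
  finally show ?thesis by (simp add: mult_ac)
qed

text \<open>The functions \<open>approach t \<epsilon> 0\<close> are Lipschitz in \<open>t\<close>
  for fixed \<open>\<epsilon>\<close> and lie within \<open>\<epsilon>\<close> of the curve for all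
  \<open>t\<close> at once.\<close>

lemma curve_continuous: "continuous_on {0..<\<tau>} curve"
proof (rule uniform_limit_theorem[where F = sequentially])
  show "uniform_limit {0..<\<tau>} (\<lambda>n t. approach t (1 / real (Suc n)) 0) curve sequentially"
  proof (rule uniform_limitI)
    fix e :: real assume "e > 0"
    then obtain N where N: "1 / real (Suc N) < e" using nat_approx_posE by blast
    have "dist (approach t (1 / real (Suc n)) 0) (curve t) < e" if "N \<le> n" "t \<in> {0..<\<tau>}" for n t
    proof -
      have "dist (approach t (1 / real (Suc n)) 0) (curve t) \<le> 1 / real (Suc n)"
        using tip_approach[of t "1 / real (Suc n)" 0] that by (simp add: curve_def dist_norm norm_minus_commute)
      also have "\<dots> \<le> 1 / real (Suc N)" using that by (simp add: frac_le)
      finally show ?thesis using N by simp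
    qed
    then show "\<forall>\<^sub>F n in sequentially. \<forall>t\<in>{0..<\<tau>}. dist (approach t (1 / real (Suc n)) 0) (curve t) < e"
      unfolding eventually_sequentially by blast
  qed
  have "continuous_on {0..<\<tau>} (\<lambda>t. approach t \<epsilon> 0)" if \<epsilon>: "\<epsilon> > 0" for \<epsilon>
  proof -
    define C where "C = (2 / \<epsilon> + M) * exp (2 / (\<epsilon> * \<epsilon>) * \<tau>)"
    have "C-lipschitz_on {0..<\<tau>} (\<lambda>t. approach t \<epsilon> 0)"
    proof (rule lipschitz_onI)
      fix s t assume "s \<in> {0..<\<tau>}" "t \<in> {0..<\<tau>}"
      then show "dist (approach s \<epsilon> 0) (approach t \<epsilon> 0) \<le> C * dist s t"
        using approach_Lipschitz[of s t \<epsilon>] approach_Lipschitz[of t s \<epsilon>] \<epsilon>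
        by (cases "s \<le> t") (auto simp: dist_norm norm_minus_commute C_def)
    qed (use \<epsilon> M_nonneg in \<open>simp add: C_def\<close>)
    then show ?thesis by (rule lipschitz_on_continuous_on)
  qed
  then show "\<forall>\<^sub>F n in sequentially. continuous_on {0..<\<tau>} (\<lambda>t. approach t (1 / real (Suc n)) 0)"
    by (intro always_eventually allI) simp
qed simp


section \<open>Complement of the curve\<close>

text \<open>Forward continuation is reduced to the backward flow: some end point at a later time
  must flow back through the current position \<open>w\<close>, and Brouwer's theorem supplies
  it.\<close>

lemma D_extend:
  assumes t: "0 \<le> t" "t < \<tau>" and z: "z \<in> D t"
  obtains t' where "t < t'" "t' < \<tau>" "z \<in> D t'"
proof -
  obtain x where x: "flow t x" "x 0 = z" using D_iff[OF t] z by auto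
  define w where "w = x t"
  define r where "r = Im w / 2"
  have r: "r > 0" using flow_Im_pos[OF x(1), of t] t by (simp add: r_def w_def)
  \<comment> \<open>The first bound keeps the displacement \<open>2 / r * h\<close> within the
    radius \<open>r\<close>, the second keeps \<open>t + h\<close> below
    \<open>\<tau>\<close>.\<close>
  define h where "h = min (r\<^sup>2 / 2) ((\<tau> - t) / 2)"
  have h: "0 < h" "t + h < \<tau>" "2 / r * h \<le> r"
    using r t by (auto simp: h_def min_def field_simps power2_eq_square)
  have t': "0 \<le> t + h" using t h by simp
  have near: "r \<le> Im v" if "v \<in> cball w r" for v
  proof -
    have "\<bar>Im (w - v)\<bar> \<le> r" using that abs_Im_le_cmod[of "w - v"] by (simp add: dist_norm)
    then show ?thesis unfolding r_def minus_complex.sel by linarith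
  qed
  \<comment> \<open>A fixed point of \<open>p\<close> is an end point whose trajectory passes
    through \<open>w\<close> at time \<open>t\<close>.\<close>
  define p where "p v = v - tr (t + h) v t + w" for v
  obtain v where v: "v \<in> cball w r" "p v = v"
  proof (rule brouwer_ball[OF r])
    show "continuous_on (cball w r) p"
      unfolding p_def
    proof (intro continuous_intros continuous_at_imp_continuous_on ballI)
      fix v assume "v \<in> cball w r"
      then show "isCont (\<lambda>v. tr (t + h) v t) v"
        unfolding isCont_def using near[of v] r h t t' by (intro tr_tendsto) auto
    qed
    show "p \<in> cball w r \<rightarrow> cball w r"
    proof
      fix v assume v: "v \<in> cball w r"
      have pos: "0 < Im v" using near[OF v] r by simp
      note f = tr[OF t' h(2) pos]
      have "cmod (v - tr (t + h) v t) \<le> 2 / r * (t + h - t)"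
        using flow_displacement_Im[OF f(1) t(1) _ order_refl r] near[OF v] h(1) by (simp add: f(2))
      also have "\<dots> \<le> r" using h(3) by simp
      finally show "p v \<in> cball w r"
        by (simp add: p_def dist_norm norm_minus_commute)
    qed
  qed
  have pos: "0 < Im v" using near[OF v(1)] r by simp
  note f = tr[OF t' h(2) pos]
  have "tr (t + h) v t = x t" using v(2) by (simp add: p_def w_def)
  then have "tr (t + h) v 0 = x 0"
    by (rule flow_unique[OF flow_restrict[OF f(1)] x(1) t(2), rotated -1]) (use h t in auto)
  then have "z \<in> D (t + h)" using D_iff[OF t' h(2)] f(1) x(2) by auto
  then show ?thesis using that[of "t + h"] h by simp
qed

text \<open>The logarithmic derivative of \<open>Im x\<close> is -2 divided by the squared distance
  from the driver.\<close>

lemma flow_Im_lower: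
  assumes x: "flow t x" and t: "0 \<le> s" "s \<le> t" and \<delta>: "\<delta> > 0"
    and far: "\<And>q. q \<in> {0..s} \<Longrightarrow> \<delta> \<le> cmod (x q - of_real (lam q))"
  shows "Im (x 0) * exp (- (2 / \<delta>\<^sup>2) * s) \<le> Im (x s)"
proof -
  have "- (2 / \<delta>\<^sup>2) * (s - 0) \<le> ln (Im (x s)) - ln (Im (x 0))"
  proof (rule diff_ge_of_deriv_ge[OF t(1)])
    fix q assume q: "q \<in> {0..s}"
    have pos: "0 < Im (x q)" using flow_Im_pos[OF x, of q] q t by auto
    show "((\<lambda>q. ln (Im (x q))) has_real_derivative
        (1 / Im (x q)) * (- (2 * Im (x q) / (cmod (x q - of_real (lam q)))\<^sup>2))) (at q within {0..s})"
      by (rule DERIV_chain'[where g = ln, OF flow_Im_deriv[OF x q _ t(2)] DERIV_ln_divide[OF pos]]) simp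
    have "2 / (cmod (x q - of_real (lam q)))\<^sup>2 \<le> 2 / \<delta>\<^sup>2"
      using far[OF q] \<delta> by (intro frac_le power_mono) auto
    then show "- (2 / \<delta>\<^sup>2) \<le> (1 / Im (x q)) * (- (2 * Im (x q) / (cmod (x q - of_real (lam q)))\<^sup>2))"
      using pos by simp
  qed
  then have "ln (Im (x 0)) - (2 / \<delta>\<^sup>2) * s \<le> ln (Im (x s))" by simp
  then have "exp (ln (Im (x 0)) - (2 / \<delta>\<^sup>2) * s) \<le> exp (ln (Im (x s)))" by (rule exp_le_cancel_iff[THEN iffD2])
  then show ?thesis
    using flow_Im_pos[OF x, of s] flow_Im_pos[OF x, of 0] t by (simp add: exp_diff exp_minus divide_inverse)
qed

text \<open>A point swallowed exactly at time \<open>T\<close> collides with the driver: if its distance to the driver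
  stayed bounded below, the trajectory would stay in a compact subset of the half-plane and extend
  to time \<open>T\<close>.\<close>
lemma collision:
  assumes T: "0 < T" "T < \<tau>" and z: "Im z > 0" "z \<notin> D T"
    and X: "\<And>s. 0 \<le> s \<Longrightarrow> s < T \<Longrightarrow> flow s (X s)" "\<And>s. 0 \<le> s \<Longrightarrow> s < T \<Longrightarrow> X s 0 = z"
    and \<eta>: "\<eta> > 0"
  obtains s where "0 \<le> s" "T - \<eta> < s" "s < T" "cmod (X s s - of_real (lam s)) < \<eta>"
proof (rule ccontr)
  assume "\<not> thesis"
  then have far: "\<eta> \<le> cmod (X s s - of_real (lam s))" if "0 \<le> s" "T - \<eta> < s" "s < T" for s
    using that \<open>\<not> thesis\<close> \<open>\<And>s. _ \<Longrightarrow> _ \<Longrightarrow> _ \<Longrightarrow> _ \<Longrightarrow> thesis\<close> by force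
  have X_eq: "X s r = X r r" if "0 \<le> r" "r \<le> s" "s < T" for r s
  proof (rule flow_unique[where t = r and r = 0 and x = "X s" and y = "X r"])
    show "flow r (X s)" by (rule flow_restrict[OF X(1)[of s] that(2)]) (use that in auto)
  qed (use that T X in auto)
  define s0 where "s0 = max 0 (T - \<eta> / 2)"
  have s0: "0 \<le> s0" "s0 < T" "T - \<eta> < s0" using T \<eta> by (auto simp: s0_def)
  \<comment> \<open>After \<open>s0\<close> the distance to the driver is at least
    \<open>\<eta>\<close>; up to \<open>s0\<close> it is at least the height, which is smallest at
    \<open>s0\<close>.\<close>
  define \<delta> where "\<delta> = min \<eta> (Im (X s0 s0))"
  have \<delta>: "\<delta> > 0" using \<eta> flow_Im_pos[OF X(1)[OF s0(1,2)], of s0] s0 by (simp add: \<delta>_def)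
  have far': "\<delta> \<le> cmod (X s s - of_real (lam s))" if "0 \<le> s" "s < T" for s
  proof (cases "s \<le> s0")
    case True
    have "Im (X s0 s0) \<le> Im (X s s)"
      using flow_Im_antimono[OF X(1)[OF s0(1,2)] that(1) True order_refl] X_eq[OF that(1) True s0(2)] by simp
    moreover have "Im (X s s) \<le> cmod (X s s - of_real (lam s))"
      using flow_Im_pos[OF X(1)[OF that], of s] that by (intro norm_diff_driver_ge) auto
    ultimately show ?thesis by (simp add: \<delta>_def)
  next
    case False
    then show ?thesis using far[of s] s0 that by (simp add: \<delta>_def)
  qed
  have far'': "\<delta> \<le> cmod (X s q - of_real (lam q))" if "q \<in> {0..s}" "s < T" for s q
    using X_eq[of q s] far'[of q] that by auto
  define c where "c = Im z * exp (- (2 / \<delta>\<^sup>2) * T)"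
  have c: "c > 0" using z by (simp add: c_def)
  have low: "c \<le> Im (X s s)" if "0 \<le> s" "s < T" for s
  proof -
    have "c \<le> Im z * exp (- (2 / \<delta>\<^sup>2) * s)"
      unfolding c_def using that z by (intro mult_left_mono) (auto intro!: divide_right_mono)
    also have "\<dots> \<le> Im (X s s)"
      using flow_Im_lower[OF X(1)[OF that] that(1) order_refl \<delta> far''] X(2)[OF that] that by simp
    finally show ?thesis .
  qed
  have bnd: "X s s \<in> cball z (2 / \<delta> * T)" if "0 \<le> s" "s < T" for s
  proof -
    have "cmod (X s s - X s 0) \<le> 2 / \<delta> * (s - 0)"
      by (rule flow_displacement[OF X(1)[OF that] _ that(1) order_refl \<delta> far'']) (use that in auto)
    also have "\<dots> \<le> 2 / \<delta> * T" using that \<delta> by (intro mult_left_mono) auto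
    finally show ?thesis using X(2)[OF that] by (simp add: dist_norm norm_minus_commute)
  qed
  define s where "s n = T - T / real (Suc (Suc n))" for n
  have s: "0 \<le> s n" "s n < T" for n using T by (auto simp: s_def field_simps)
  have "(\<lambda>n. T - T * (1 / real (Suc (Suc n)))) \<longlonglongrightarrow> T - T * 0"
    by (intro tendsto_intros LIMSEQ_Suc[OF LIMSEQ_Suc[OF lim_1_over_n[where 'a = real]]])
  then have s_lim: "s \<longlonglongrightarrow> T" by (simp add: s_def[abs_def])
  \<comment> \<open>A limit position at time \<open>T\<close>, at height at least \<open>c\<close>.
    The trajectory ending there is next shown to start at \<open>z\<close>, contradicting that
    \<open>z\<close> is swallowed.\<close>
  obtain p \<sigma> where p: "strict_mono \<sigma>" "((\<lambda>n. X (s n) (s n)) \<circ> \<sigma>) \<longlonglongrightarrow> p"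
    using compact_cball[of z "2 / \<delta> * T", unfolded compact_def] bnd[OF s] by meson
  define \<theta> where "\<theta> n = s (\<sigma> n)" for n
  have \<theta>: "0 \<le> \<theta> n" "\<theta> n < T" for n using s by (auto simp: \<theta>_def)
  have \<theta>_lim: "\<theta> \<longlonglongrightarrow> T" using LIMSEQ_subseq_LIMSEQ[OF s_lim p(1)] by (simp add: \<theta>_def[abs_def] o_def)
  have p_lim: "(\<lambda>n. X (\<theta> n) (\<theta> n)) \<longlonglongrightarrow> p" using p(2) by (simp add: \<theta>_def o_def)
  have pc: "c \<le> Im p"
    by (rule LIMSEQ_le_const[OF tendsto_Im[OF p_lim]]) (use low \<theta> in auto)
  then have p_pos: "Im p > 0" using c by simp
  have T0: "0 \<le> T" using T by simp
  note f = tr[OF T0 T(2) p_pos]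
  have "cmod (tr T p 0 - z) \<le> (2 / c * (T - \<theta> n) + cmod (p - X (\<theta> n) (\<theta> n))) * exp (2 / (c * c) * \<tau>)" for n
  proof -
    have pt: "Im p \<le> Im (tr T p (\<theta> n))"
      using flow_Im_antimono[OF f(1), of "\<theta> n" T] \<theta>[of n] f(2) by auto
    have "cmod (p - tr T p (\<theta> n)) \<le> 2 / c * (T - \<theta> n)"
      using flow_displacement_Im[OF f(1), of "\<theta> n" T c] \<theta>[of n] f(2) c pc by auto
    then have "cmod (tr T p (\<theta> n) - X (\<theta> n) (\<theta> n)) \<le> 2 / c * (T - \<theta> n) + cmod (p - X (\<theta> n) (\<theta> n))"
      using norm_triangle_ineq[of "tr T p (\<theta> n) - p" "p - X (\<theta> n) (\<theta> n)"] by (simp add: norm_minus_commute)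
    then have "cmod (tr T p (\<theta> n) - X (\<theta> n) (\<theta> n)) * exp (2 / (c * c) * \<tau>)
        \<le> (2 / c * (T - \<theta> n) + cmod (p - X (\<theta> n) (\<theta> n))) * exp (2 / (c * c) * \<tau>)"
      by (rule mult_right_mono) simp
    moreover have "cmod (tr T p 0 - X (\<theta> n) 0) \<le> cmod (tr T p (\<theta> n) - X (\<theta> n) (\<theta> n)) * exp (2 / (c * c) * \<tau>)"
      by (rule flow_diff_norm_Im[OF flow_restrict[OF f(1)] X(1)[OF \<theta>]])
        (use \<theta>[of n] T c pt pc low in auto)
    ultimately show ?thesis unfolding X(2)[OF \<theta>] by (rule order_trans[rotated])
  qed
  moreover have "(\<lambda>n. (2 / c * (T - \<theta> n) + cmod (p - X (\<theta> n) (\<theta> n))) * exp (2 / (c * c) * \<tau>))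
      \<longlonglongrightarrow> (2 / c * (T - T) + cmod (p - p)) * exp (2 / (c * c) * \<tau>)"
    by (intro tendsto_intros \<theta>_lim p_lim)
  ultimately have "cmod (tr T p 0 - z) \<le> (2 / c * (T - T) + cmod (p - p)) * exp (2 / (c * c) * \<tau>)"
    by (elim LIMSEQ_le_const) (rule exI[of _ 0], simp)
  then have "z \<in> D T" using D_iff[OF T0 T(2)] f(1) by auto
  then show False using z by simp
qed

text \<open>Let \<open>T\<close> be the supremum of the survival times of \<open>z\<close>. The
  trajectory of \<open>z\<close> collides with the driver at \<open>T\<close>, which forces it into
  the sector all along. There it is compared with \<open>tip T\<close>, and contraction makes the
  two starting points equal.\<close>

lemma swallowed_on_curve:
  assumes t: "0 \<le> t" "t < \<tau>" and z: "Im z > 0" "z \<notin> D t"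
  shows "z \<in> curve ` {0<..t}"
proof -
  define S where "S = {s \<in> {0..t}. z \<in> D s}"
  define T where "T = Sup S"
  have S0: "0 \<in> S" using D_0 z t by (simp add: S_def)
  have bdd: "bdd_above S" by (rule bdd_aboveI[of _ t]) (auto simp: S_def)
  have Tt: "0 \<le> T" "T \<le> t"
    using cSup_upper[OF S0 bdd] S0 by (auto simp: T_def S_def intro!: cSup_least)
  have T\<tau>: "T < \<tau>" using Tt t by simp
  have inD: "z \<in> D s" if s: "0 \<le> s" "s < T" for s
  proof -
    obtain q where "q \<in> S" "s < q" using less_cSupD[of S s] S0 s by (auto simp: T_def)
    then show ?thesis using D_subset[of s q] s t by (auto simp: S_def)
  qed
  \<comment> \<open>Survival is an open condition in time, so the supremum is not attained.\<close>
  have notD: "z \<notin> D T"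
  proof
    assume "z \<in> D T"
    then obtain T' where T': "T < T'" "T' < \<tau>" "z \<in> D T'" using D_extend[OF Tt(1) T\<tau>] by metis
    have "T \<noteq> t" using \<open>z \<in> D T\<close> z by auto
    then have "min T' t \<in> S" "T < min T' t"
      using T' Tt D_subset[of "min T' t" T'] by (auto simp: S_def min_def)
    then show False using cSup_upper[OF _ bdd] by (fastforce simp: T_def)
  qed
  have T: "0 < T" using notD Tt(1) D_0 z by (cases "T = 0") auto
  \<comment> \<open>One trajectory of \<open>z\<close> is chosen for each time before
    \<open>T\<close>; by \<open>X_eq\<close> they are consistent, and \<open>X s s\<close> is the
    position at time \<open>s\<close>.\<close>
  define X where "X s = (SOME x. flow s x \<and> x 0 = z)" for s
  have X: "flow s (X s) \<and> X s 0 = z" if "0 \<le> s" "s < T" for s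
  proof -
    have "\<exists>x. flow s x \<and> x 0 = z" using inD[OF that] D_iff[of s z] that T\<tau> by simp
    then show ?thesis unfolding X_def by (rule someI_ex)
  qed
  have X_eq: "X s r = X r r" if "0 \<le> r" "r \<le> s" "s < T" for r s
  proof (rule flow_unique[where t = r and r = 0 and x = "X s" and y = "X r"])
    show "flow r (X s)" by (rule flow_restrict[OF conjunct1[OF X[of s]] that(2)]) (use that in auto)
  qed (use that T\<tau> X in auto)
  have close: "\<exists>s. 0 \<le> s \<and> T - \<eta> < s \<and> s < T \<and> cmod (X s s - of_real (lam s)) < \<eta>" if "\<eta> > 0" for \<eta>
    by (rule collision[OF T T\<tau> z(1) notD _ _ that, of X]) (use X in auto)
  have sector: "(Re (X r r) - lam r)\<^sup>2 \<le> (Im (X r r))\<^sup>2" if r: "0 \<le> r" "r < T" for r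
  proof -
    have "(Re (X r r) - lam r)\<^sup>2 - (Im (X r r))\<^sup>2 \<le> 0 + e" if e: "e > 0" for e
    proof -
      \<comment> \<open>The bounds \<open>e\<close> and 1 give \<open>\<eta>^2 \<le> e\<close>, the
        bound \<open>T - r\<close> puts the collision time after \<open>r\<close>, and the last one
        secures \<open>M * \<bar>Re (X s s) - lam s\<bar> \<le> 1/2\<close>.\<close>
      define \<eta> where "\<eta> = min (min e 1) (min (T - r) (1 / (2 * (M + 1))))"
      have M1: "M + 1 > 0" using M_nonneg by simp
      have \<eta>: "\<eta> > 0" "\<eta> \<le> e" "\<eta> \<le> 1" "\<eta> \<le> T - r" "\<eta> \<le> 1 / (2 * (M + 1))"
        using e r M1 by (auto simp: \<eta>_def)
      obtain s where s: "0 \<le> s" "T - \<eta> < s" "s < T" "cmod (X s s - of_real (lam s)) < \<eta>"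
        using close[OF \<eta>(1)] by auto
      have Xs: "\<bar>Re (X s s) - lam s\<bar> \<le> \<eta>"
        using s(4) abs_Re_le_cmod[of "X s s - of_real (lam s)"] by simp
      have "M * \<bar>Re (X s s) - lam s\<bar> \<le> (M + 1) * (1 / (2 * (M + 1)))"
        using Xs \<eta>(5) M_nonneg by (intro mult_mono) auto
      also have "(M + 1) * (1 / (2 * (M + 1))) = 1/2" using M1 by (simp add: divide_simps)
      finally have "M * \<bar>Re (X s s) - lam s\<bar> \<le> 1/2" .
      from flow_Re_square_backward[OF conjunct1[OF X[OF s(1,3)]] _ r(1) _ order_refl this]
      have "(Re (X s r) - lam r)\<^sup>2 - (Im (X s r))\<^sup>2 \<le> (Re (X s s) - lam s)\<^sup>2 - (Im (X s s))\<^sup>2 - (s - r)"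
        using s \<eta> T\<tau> by auto
      also have "\<dots> \<le> (Re (X s s) - lam s)\<^sup>2"
        using s \<eta> zero_le_power2[of "Im (X s s)"] by linarith
      also have "\<dots> \<le> \<eta>\<^sup>2" using Xs by (simp add: abs_le_square_iff[symmetric])
      also have "\<dots> \<le> \<eta>" using \<eta> by (simp add: power2_eq_square mult_left_le)
      finally show ?thesis using X_eq[OF r(1), of s] s \<eta> by simp
    qed
    then show ?thesis using field_le_epsilon[of "(Re (X r r) - lam r)\<^sup>2 - (Im (X r r))\<^sup>2" 0] by simp
  qed
  have "cmod (z - curve T) \<le> 0 + e" if e: "e > 0" for e
  proof -
    define K where "K = 3 + M"
    have K: "K > 0" using M_nonneg by (simp add: K_def)
    \<comment> \<open>A square, so that the term \<open>2 * sqrt \<eta>\<close> from the height of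
      the tip is explicit; then \<open>\<eta> + M * \<eta> + 2 * sqrt \<eta>\<close> is at most
      \<open>K\<close> times its root.\<close>
    define \<eta> where "\<eta> = min 1 (e / K) ^ 2"
    have \<eta>0: "0 < min 1 (e / K)" "min 1 (e / K) \<le> 1" using e K by auto
    have \<eta>: "\<eta> > 0" "\<eta> \<le> min 1 (e / K)" "sqrt \<eta> = min 1 (e / K)"
      using \<eta>0 mult_right_mono[OF \<eta>0(2), of "min 1 (e / K)"]
      by (auto simp: \<eta>_def power2_eq_square[of "min _ _"] simp del: min_less_iff_conj)
    obtain s where s: "0 \<le> s" "T - \<eta> < s" "s < T" "cmod (X s s - of_real (lam s)) < \<eta>"
      using close[OF \<eta>(1)] by auto
    have s\<tau>: "s < \<tau>" using s T\<tau> by simp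
    have "cmod (z - curve T) = cmod (X s 0 - tip T 0)" using X s by (simp add: curve_def)
    also have "\<dots> \<le> cmod (X s s - tip T s)"
    proof (rule flow_diff_sector[OF conjunct1[OF X[OF s(1,3)]] tip_flow[OF s(1,3) T\<tau>] s\<tau> order_refl s(1) order_refl])
      fix q assume q: "q \<in> {0..s}"
      show "(Re (X s q) - lam q)\<^sup>2 \<le> (Im (X s q))\<^sup>2" using sector[of q] X_eq[of q s] q s by auto
      show "(Re (tip T q) - lam q)\<^sup>2 \<le> (Im (tip T q))\<^sup>2" using tip_bounds(1)[of T q] q s T\<tau> by auto
    qed
    also have "\<dots> \<le> cmod (X s s - of_real (lam s)) + cmod (tip T s - of_real (lam s))"
      using norm_triangle_ineq4[of "X s s - of_real (lam s)" "tip T s - of_real (lam s)"] by simp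
    also have "\<dots> \<le> \<eta> + (M * \<eta> + 2 * sqrt \<eta>)"
    proof (intro add_mono)
      have B: "\<bar>Re (tip T s) - lam s\<bar> \<le> M * (T - s)" "Im (tip T s) \<le> 2 * sqrt (T - s)" "0 \<le> Im (tip T s)"
        using tip_bounds[of T s] s T\<tau> by auto
      have "M * (T - s) \<le> M * \<eta>" "sqrt (T - s) \<le> sqrt \<eta>" using s M_nonneg by (auto intro: mult_left_mono)
      then show "cmod (tip T s - of_real (lam s)) \<le> M * \<eta> + 2 * sqrt \<eta>"
        using B cmod_le[of "tip T s - of_real (lam s)"] unfolding minus_complex.sel Re_complex_of_real Im_complex_of_real
        by linarith
    qed (use s in simp)
    also have "\<dots> \<le> min 1 (e / K) * K"
    proof -
      have "\<eta> + (M * \<eta> + 2 * m) \<le> m * K" if "\<eta> \<le> m" for m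
        using that mult_left_mono[OF that M_nonneg] by (simp add: K_def algebra_simps)
      then show ?thesis using \<eta>(2,3) by metis
    qed
    also have "\<dots> \<le> e / K * K" using K by (intro mult_right_mono) auto
    finally show ?thesis using K by simp
  qed
  then have "cmod (z - curve T) \<le> 0" by (rule field_le_epsilon)
  then have "z = curve T" by simp
  then show ?thesis using T Tt by auto
qed

lemma D_eq: 
  assumes t: "0 \<le> t" "t < \<tau>"
  shows "D t = upper_half_plane - curve ` {0<..t}"
proof
  show "D t \<subseteq> upper_half_plane - curve ` {0<..t}"
    using D_Im_pos[OF t] curve_in_D_iff[of _ t] t by (auto simp: upper_half_plane_def)
  show "upper_half_plane - curve ` {0<..t} \<subseteq> D t"
    using swallowed_on_curve[OF t] by (auto simp: upper_half_plane_def)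
qed


section \<open>The Loewner maps\<close>

definition gmap :: "real \<Rightarrow> complex \<Rightarrow> complex" where
  "gmap t = inv_into {w. Im w > 0} (\<lambda>w. tr t w 0)"

lemma gmap_eq:
  assumes "flow t x" "0 \<le> t" "t < \<tau>" "s \<in> {0..t}"
  shows "gmap s (x 0) = x s"
proof -
  have s: "0 \<le> s" "s < \<tau>" "s \<le> t" using assms by auto
  have "x s \<in> {w. Im w > 0}" using flow_Im_pos[OF assms(1,4)] by simp
  then have "gmap s (tr s (x s) 0) = x s"
    unfolding gmap_def by (rule inv_into_f_f[OF tr_inj[OF s(1,2)]])
  moreover have "tr s (x s) 0 = x 0"
    by (rule tr_eq[OF flow_restrict[OF assms(1) s(3)] s(1,2)]) (use s in auto)
  ultimately show ?thesis by simp
qed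

lemma gmap_holomorphic:
  assumes t: "0 \<le> t" "t < \<tau>"
  shows "gmap t holomorphic_on D t"
proof -
  obtain h where h: "h holomorphic_on D t" "\<And>w. w \<in> {w. Im w > 0} \<Longrightarrow> h (tr t w 0) = w"
    using holomorphic_has_inverse[OF tr_holomorphic[OF t] open_halfspace_Im_gt tr_inj[OF t]]
    unfolding D_def by metis
  have "h z = gmap t z" if "z \<in> D t" for z
    using that h(2) inv_into_f_f[OF tr_inj[OF t]] by (auto simp: D_def gmap_def)
  then show ?thesis using holomorphic_transform[OF h(1)] by blast
qed

lemma gmap_bij: "0 \<le> t \<Longrightarrow> t < \<tau> \<Longrightarrow> bij_betw (gmap t) (D t) upper_half_plane"
  unfolding gmap_def D_def upper_half_plane_def
  by (rule bij_betw_inv_into) (simp add: bij_betw_def tr_inj)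

lemma gmap_0: "Im z > 0 \<Longrightarrow> gmap 0 z = z"
  using gmap_eq[OF tr(1)[of 0 z], of 0] tr(2)[of 0 z] tau_pos by auto

text \<open>For t > 0 the derivative is two-sided, so the trajectory of \<open>z\<close> has to live
  beyond \<open>t\<close>; \<open>D_extend\<close> provides this.\<close>

lemma gmap_ode:
  assumes t: "0 \<le> t" "t < \<tau>" and z: "z \<in> D t"
  shows "((\<lambda>s. gmap s z) has_vector_derivative 2 / (gmap t z - of_real (lam t))) (at t within {0..<\<tau>})"
proof -
  obtain t' where t': "t < t'" "t' < \<tau>" "z \<in> D t'" using D_extend[OF t z] .
  obtain x where x: "flow t' x" "x 0 = z" using D_iff[of t' z] t' t by auto
  have eq: "gmap s z = x s" if "s \<in> {0..t'}" for s
    using gmap_eq[OF x(1) _ t'(2) that] x(2) t t' by simp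
  have tin: "t \<in> {0..t'}" using t t' by simp
  have "(x has_vector_derivative 2 / (gmap t z - of_real (lam t))) (at t within {0..t'})"
    using flow_deriv[OF x(1) tin] eq[OF tin] by simp
  then have "((\<lambda>s. gmap s z) has_vector_derivative 2 / (gmap t z - of_real (lam t))) (at t within {0..t'})"
    by (rule has_vector_derivative_transform[OF tin eq, rotated])
  moreover have "at t within {0..t'} = at t within {0..<\<tau>}"
    by (rule at_within_nhd[where S = "{..<t'}"]) (use t' in auto)
  ultimately show ?thesis by simp
qed

text \<open>For large \<open>z\<close> the trajectory stays within a fixed distance of
  \<open>z\<close> and far from the driver, so the error has derivative
  \<open>2 / \<omega> - 2 / z = 2 * (z - \<omega>) / (z * \<omega>)\<close> of order
  \<open>1 / (cmod z)^2\<close>, where \<omega> is \<open>x s - lam s\<close>.\<close>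

lemma gmap_expansion:
  assumes t: "0 \<le> t" "t < \<tau>"
  shows "\<exists>C R. \<forall>z\<in>upper_half_plane. norm z > R \<longrightarrow>
    norm (gmap t z - z - 2 * complex_of_real t / z) \<le> C / (norm z)\<^sup>2"
proof -
  have "compact (curve ` {0..t})"
    by (intro compact_continuous_image continuous_on_subset[OF curve_continuous]) (use t in auto)
  \<comment> \<open>Beyond radius \<open>R0\<close> there is no point of the curve, so such
    \<open>z\<close> lie in \<open>D t\<close>.\<close>
  then obtain R0 where R0: "\<And>s. s \<in> {0..t} \<Longrightarrow> cmod (curve s) \<le> R0"
    by (meson bounded_iff compact_imp_bounded imageI)
  \<comment> \<open>\<open>B\<close> collects the driver motion and the possible loss of height;
    \<open>E\<close> adds the displacement of the trajectory, whose speed is at most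
    \<open>8 / cmod z\<close>, and the size of the driver.\<close>
  define B where "B = M * \<tau> + 2 * sqrt \<tau>"
  define E where "E = 8 * \<tau> + M * \<tau>"
  have BE: "0 \<le> B" "0 \<le> E" using M_nonneg tau_pos by (auto simp: B_def E_def)
  have "norm (gmap t z - z - 2 * complex_of_real t / z) \<le> (8 * E * \<tau>) / (norm z)\<^sup>2"
    if z: "z \<in> upper_half_plane" "norm z > max R0 (max 1 (2 * B))" for z
  proof -
    have "z \<notin> curve ` {0<..t}"
    proof
      assume "z \<in> curve ` {0<..t}"
      then obtain s where "s \<in> {0<..t}" "z = curve s" by blast
      then show False using R0[of s] z(2) by simp
    qed
    then have "z \<in> D t" using z D_eq[OF t] by simp
    then obtain x where x: "flow t x" "x 0 = z" using D_iff[OF t] by auto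
    have z1: "cmod z > 1" "cmod z > 2 * B" using z by auto
    then have z0: "z \<noteq> 0" by auto
    have far: "cmod z / 4 \<le> cmod (x s - of_real (lam s))" if s: "s \<in> {0..t}" for s
    proof -
      have pos: "0 < Im (x s)" "0 < Im (x 0)" using flow_Im_pos[OF x(1)] s by auto
      have "\<bar>Re (x 0) - lam 0\<bar> \<le> \<bar>Re (x s) - lam s\<bar> + M * (s - 0)"
        by (rule flow_Re_backward[OF x(1) t(2)]) (use s in auto)
      also have "M * (s - 0) \<le> M * \<tau>" using s t M_nonneg by (intro mult_left_mono) auto
      finally have 1: "\<bar>Re z\<bar> \<le> \<bar>Re (x s) - lam s\<bar> + M * \<tau>" by (simp add: x(2) lam_0)
      have "(Im (x 0))\<^sup>2 \<le> (Im (x s))\<^sup>2 + 4 * (s - 0)"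
        by (rule flow_Im_square_le[OF x(1)]) (use s in auto)
      also have "\<dots> \<le> (Im (x s) + 2 * sqrt \<tau>)\<^sup>2"
      proof -
        have "0 \<le> Im (x s) * sqrt \<tau>" using pos tau_pos by simp
        then show ?thesis using s t tau_pos by (simp add: power2_sum power_mult_distrib)
      qed
      finally have 2: "\<bar>Im z\<bar> \<le> Im (x s) + 2 * sqrt \<tau>"
        using pos tau_pos x(2) by (subst (asm) abs_le_square_iff[symmetric]) auto
      have "cmod z \<le> \<bar>Re (x s) - lam s\<bar> + Im (x s) + B"
        using cmod_le[of z] 1 2 by (simp add: B_def)
      also have "\<dots> \<le> 2 * cmod (x s - of_real (lam s)) + B"
        using abs_Re_le_cmod[of "x s - of_real (lam s)"] norm_diff_driver_ge[OF pos(1), of "lam s"] by simp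
      finally show ?thesis using z1 by simp
    qed
    have d0: "cmod z / 4 > 0" using z0 by simp
    have near: "cmod (z - (x s - of_real (lam s))) \<le> E" if s: "s \<in> {0..t}" for s
    proof -
      have "cmod (x s - x 0) \<le> 2 / (cmod z / 4) * (s - 0)"
        by (rule flow_displacement[OF x(1) _ _ _ d0 far]) (use s in auto)
      also have "\<dots> \<le> 8 * \<tau>"
      proof -
        have "s * 1 \<le> \<tau> * cmod z" using z1(1) s t by (intro mult_mono) auto
        then show ?thesis using z0 by (simp add: divide_le_eq)
      qed
      finally have "cmod (z - x s) \<le> 8 * \<tau>" by (simp add: x(2) norm_minus_commute)
      moreover have "\<bar>lam s\<bar> \<le> M * \<tau>"
        using lam_Lipschitz[of 0 s] s t M_nonneg mult_left_mono[of s \<tau> M] by (simp add: lam_0)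
      ultimately show ?thesis
        using norm_triangle_ineq[of "z - x s" "of_real (lam s)"] by (simp add: E_def algebra_simps)
    qed
    define e where "e s = x s - z - (2 * of_real s) / z" for s
    have "cmod (e t - e 0) \<le> (8 * E / (cmod z)\<^sup>2) * (t - 0)"
    proof (rule norm_diff_le_of_deriv_le[OF t(1)])
      fix s assume s: "s \<in> {0..t}"
      let ?\<omega> = "x s - of_real (lam s)"
      show "(e has_vector_derivative (2 / ?\<omega> - 0 - 2 / z)) (at s within {0..t})"
        unfolding e_def
        by (intro has_vector_derivative_diff has_vector_derivative_const flow_deriv[OF x(1) s])
          (auto intro!: derivative_eq_intros simp: scaleR_conv_of_real)
      have "?\<omega> \<noteq> 0" using far[OF s] d0 by auto
      then have "2 / ?\<omega> - 0 - 2 / z = 2 * (z - ?\<omega>) / (z * ?\<omega>)"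
        using z0 by (simp add: divide_simps)
      then have "cmod (2 / ?\<omega> - 0 - 2 / z) = 2 * cmod (z - ?\<omega>) / (cmod z * cmod ?\<omega>)"
        by (simp only: norm_mult norm_divide) simp
      also have "\<dots> \<le> 2 * E / (cmod z * (cmod z / 4))"
        using near[OF s] far[OF s] d0 BE by (intro frac_le mult_left_mono mult_pos_pos) auto
      also have "\<dots> = 8 * E / (cmod z)\<^sup>2" by (simp add: power2_eq_square)
      finally show "cmod (2 / ?\<omega> - 0 - 2 / z) \<le> 8 * E / (cmod z)\<^sup>2" .
    qed
    also have "\<dots> \<le> (8 * E / (cmod z)\<^sup>2) * \<tau>"
      using t BE by (intro mult_left_mono) auto
    finally have "cmod (e t) \<le> 8 * E * \<tau> / (cmod z)\<^sup>2" by (simp add: e_def x(2))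
    moreover have "gmap t z = x t" using gmap_eq[OF x(1) t, of t] x(2) t by auto
    ultimately show ?thesis by (simp add: e_def)
  qed
  then show ?thesis by blast
qed

text \<open>Time is split at \<open>s = t - k^2\<close>. The map \<open>gmap s\<close> is continuous
  at \<open>curve t\<close> and its value there is within order \<open>k\<close> of the driver; the
  remaining time \<open>k^2\<close> moves nearby trajectories relative to the driver by order
  \<open>k\<close> only.\<close>

lemma gmap_at_tip:
  assumes t: "0 \<le> t" "t < \<tau>"
  shows "(gmap t \<longlongrightarrow> of_real (lam t)) (at (curve t) within D t)"
proof (cases "t = 0")
  case True
  have "((\<lambda>z. z) \<longlongrightarrow> curve 0) (at (curve 0) within D 0)" by (rule tendsto_ident_at)
  then have "(gmap 0 \<longlongrightarrow> curve 0) (at (curve 0) within D 0)"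
    by (rule Lim_transform_eventually) (auto simp: eventually_at_filter D_0 gmap_0)
  then show ?thesis using True by (simp add: curve_0 lam_0)
next
  case False
  then have t0: "0 < t" using t by simp
  show ?thesis
  proof (rule tendstoI)
    fix e :: real assume e: "e > 0"
    define K where "K = 7 + 2 * M"
    have K: "K > 0" using M_nonneg by (simp add: K_def)
    \<comment> \<open>The bounds give in turn \<open>k^2 \<le> k\<close>, \<open>s \<ge> 0\<close>
      and \<open>K * k < e\<close>; \<open>K\<close> adds up the estimates 3 and 4 below.\<close>
    define k where "k = min (min 1 (sqrt t)) (e / (2 * K))"
    have k: "0 < k" "k \<le> 1" "k \<le> sqrt t" "k \<le> e / (2 * K)" using t0 e K by (auto simp: k_def)
    have kt: "k\<^sup>2 \<le> t" using k(1,3) t by (metis less_imp_le power_mono real_sqrt_pow2)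
    have k2: "k\<^sup>2 \<le> k" using k by (simp add: power2_eq_square mult_left_le)
    have Kk: "K * k < e" using k(1,4) K e by (simp add: field_simps)
    define s where "s = t - k\<^sup>2"
    have "0 < k\<^sup>2" using k(1) by simp
    then have s: "0 \<le> s" "s < t" "s < \<tau>" "t - s = k\<^sup>2"
      using kt t unfolding s_def by linarith+
    have inD: "curve t \<in> D s" using curve_in_D_iff[OF t s(1,3)] s by simp
    have gs: "gmap s (curve t) = tip t s"
      using gmap_eq[OF tip_flow[OF s(1,2) t(2)] s(1,3), of s] s by (simp add: curve_def)
    have "isCont (gmap s) (curve t)"
      using holomorphic_on_imp_continuous_on[OF gmap_holomorphic[OF s(1,3)]] D_open[OF s(1,3)] inD
      by (simp add: continuous_on_eq_continuous_at)
    then have "(gmap s \<longlongrightarrow> tip t s) (at (curve t) within D t)"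
      using gs by (auto simp: isCont_def intro: tendsto_within_subset)
    then have "\<forall>\<^sub>F z in at (curve t) within D t. dist (gmap s z) (tip t s) < k"
      using k(1) by (rule tendstoD)
    moreover have "\<forall>\<^sub>F z in at (curve t) within D t. z \<in> D t"
      by (simp add: eventually_at_filter)
    ultimately show "\<forall>\<^sub>F z in at (curve t) within D t. dist (gmap t z) (of_real (lam t)) < e"
    proof eventually_elim
      case (elim z)
      obtain x where x: "flow t x" "x 0 = z" using D_iff[OF t] elim(2) by auto
      have gx: "gmap s z = x s" "gmap t z = x t"
        using gmap_eq[OF x(1) t, of s] gmap_eq[OF x(1) t, of t] x(2) s t by auto
      have d: "cmod (x s - tip t s) < k" using elim(1) gx by (simp add: dist_norm)
      have B: "\<bar>Re (tip t s) - lam s\<bar> \<le> M * k\<^sup>2" "Im (tip t s) \<le> 2 * k"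
        using tip_bounds(2,3)[OF t, of s] s k(1) by auto
      have 1: "\<bar>Re (x s) - lam s\<bar> \<le> k + M * k\<^sup>2"
        using d B(1) abs_Re_le_cmod[of "x s - tip t s"] by simp
      have 2: "Im (x s) \<le> 3 * k"
        using d B(2) abs_Im_le_cmod[of "x s - tip t s"] by simp
      \<comment> \<open>With smoothing parameter \<open>k\<close> and elapsed time
        \<open>k^2\<close>, the repulsion costs only \<open>2 / k * k^2 = 2 * k\<close>.\<close>
      have "\<bar>Re (x t) - lam t\<bar> \<le> \<bar>Re (x s) - lam s\<bar> + k + (2 / k + M) * (t - s)"
        by (rule flow_Re_forward[OF x(1) t(2) s(1) _ order_refl k(1)]) (use s in simp)
      also have "\<dots> \<le> (k + M * k\<^sup>2) + k + (2 * k + M * k\<^sup>2)"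
        using 1 s(4) k(1) by (simp add: distrib_right power2_eq_square)
      finally have 3: "\<bar>Re (x t) - lam t\<bar> \<le> 4 * k + 2 * (M * k\<^sup>2)" by simp
      have 4: "Im (x t) \<le> 3 * k" "0 < Im (x t)"
        using flow_Im_antimono[OF x(1) s(1), of t] s 2 flow_Im_pos[OF x(1), of t] t by auto
      have "cmod (x t - of_real (lam t)) \<le> \<bar>Re (x t) - lam t\<bar> + Im (x t)"
        using cmod_le[of "x t - of_real (lam t)"] 4 by simp
      also have "\<dots> \<le> 7 * k + 2 * (M * k)"
        using 3 4 mult_left_mono[OF k2 M_nonneg] by linarith
      also have "\<dots> = K * k" by (simp add: K_def algebra_simps)
      finally show ?case using Kk gx by (simp add: dist_norm)
    qed
  qed
qed

lemma generated: "loewner_generated lam curve \<tau>"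
proof -
  have "curve_H_0_inf curve \<tau>"
    using curve_continuous curve_inj curve_0 curve_Im_pos
    by (auto simp: curve_H_0_inf_def upper_half_plane_def)
  then show ?thesis
    unfolding loewner_generated_def
  proof (intro conjI exI[of _ gmap] ballI lam_cont)
    fix z assume "z \<in> upper_half_plane"
    then show "gmap 0 z = z" by (simp add: gmap_0 upper_half_plane_def)
  qed (use gmap_holomorphic gmap_bij gmap_ode gmap_at_tip gmap_expansion in \<open>simp_all add: D_eq\<close>)
qed

end

section \<open>Driving functions of prescribed curvature\<close>

text \<open>In terms of the chart value \<open>c\<close> of \<open>x\<close>, the reciprocal \<open>1/x\<close> is \<open>- \<i> (1 - c) / (1 + c)\<close>;
  hence it is continuous away from \<open>0\<close> and vanishes at \<open>\<infinity>\<close>.\<close>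
definition ext_inverse :: "real option \<Rightarrow> real" where
  "ext_inverse v = (case v of None \<Rightarrow> 0 | Some x \<Rightarrow> 1 / x)"

lemma ext_inverse_chart:
  assumes "v \<noteq> Some 0"
  shows "ext_chart v \<noteq> - 1" "ext_inverse v = Re (- \<i> * (1 - ext_chart v) / (1 + ext_chart v))"
proof -
  have "ext_chart v \<noteq> - 1 \<and> ext_inverse v = Re (- \<i> * (1 - ext_chart v) / (1 + ext_chart v))"
  proof (cases v)
    case None
    then show ?thesis by (simp add: ext_chart_def ext_inverse_def)
  next
    case (Some x)
    then have x: "x \<noteq> 0" using assms by simp
    have ne: "complex_of_real x + \<i> \<noteq> 0" by (simp add: complex_eq_iff)
    have p: "1 + ext_chart v = 2 * complex_of_real x / (complex_of_real x + \<i>)"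
      and m: "1 - ext_chart v = 2 * \<i> / (complex_of_real x + \<i>)"
      using ne Some by (simp_all add: ext_chart_def divide_simps)
    have "1 + ext_chart v \<noteq> 0" unfolding p using x ne by simp
    moreover have "- \<i> * (1 - ext_chart v) / (1 + ext_chart v) = complex_of_real (1 / x)"
      unfolding p m using x ne by (simp add: divide_simps)
    ultimately show ?thesis using Some by (auto simp: ext_inverse_def)
  qed
  then show "ext_chart v \<noteq> - 1" "ext_inverse v = Re (- \<i> * (1 - ext_chart v) / (1 + ext_chart v))"
    by auto
qed

text \<open>The chart sends 0 to -1, so by continuity its values stay away from -1 for a short time,
  and there the Cayley formula for the reciprocal is continuous.\<close>

lemma ext_inverse_continuous:
  assumes "T > 0" "ext_continuous_on {0..T} l" "l 0 \<noteq> Some 0"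
  obtains T' where "0 < T'" "T' \<le> T" "continuous_on {0..T'} (\<lambda>t. ext_inverse (l t))"
    "\<And>t. t \<in> {0..T'} \<Longrightarrow> l t \<noteq> Some 0"
proof -
  define c where "c t = ext_chart (l t)" for t
  have c: "continuous_on {0..T} c"
    using assms(2) by (simp add: ext_continuous_on_def c_def o_def)
  have "c 0 \<noteq> - 1" using ext_inverse_chart(1)[OF assms(3)] by (simp add: c_def)
  then have "0 < dist (c 0) (- 1)" by simp
  then obtain d where d: "d > 0" "\<And>t. t \<in> {0..T} \<Longrightarrow> dist t 0 < d \<Longrightarrow> dist (c t) (c 0) < dist (c 0) (- 1)"
    using c assms(1) unfolding continuous_on_iff by (metis atLeastAtMost_iff less_imp_le order_refl)
  define T' where "T' = min T (d / 2)"
  have T': "0 < T'" "T' \<le> T" using d assms(1) by (auto simp: T'_def)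
  have ne: "c t \<noteq> - 1" if "t \<in> {0..T'}" for t
    using d(2)[of t] d(1) that T' by (auto simp: dist_commute T'_def)
  have zero: "l t \<noteq> Some 0" if "t \<in> {0..T'}" for t
    using ne[OF that] by (auto simp: c_def ext_chart_def)
  have "continuous_on {0..T'} (\<lambda>t. Re (- \<i> * (1 - c t) / (1 + c t)))"
  proof (intro continuous_intros continuous_on_subset[OF c] ballI)
    show "1 + c t \<noteq> 0" if "t \<in> {0..T'}" for t
      using ne[OF that] by (metis add_diff_cancel_left' diff_0)
  qed (use T' in auto)
  then have "continuous_on {0..T'} (\<lambda>t. ext_inverse (l t))"
    by (rule continuous_on_eq) (use ext_inverse_chart(2) zero in \<open>auto simp: c_def\<close>)
  then show ?thesis using that T' zero by blast
qed

text \<open>The value \<infinity> corresponds to a vanishing second derivative, and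
  \<open>d \<noteq> 0\<close> then selects the convention for \<open>x / 0\<close> rather than the
  one for \<open>0 / 0\<close>.\<close>

lemma loewner_curvature_val_inverse:
  assumes "d \<noteq> 0" "v \<noteq> Some 0"
  shows "loewner_curvature_val d (ext_inverse v * d ^ 3) = v"
  using assms by (cases v) (auto simp: loewner_curvature_val_def ext_inverse_def)

text \<open>A Bernoulli equation: \<open>u = d1^(-2)\<close> satisfies the linear equation
  \<open>u' = - 2 * m\<close>, and \<open>T'\<close> is chosen so that \<open>u\<close> stays
  positive.\<close>

lemma curvature_ode:
  fixes m :: "real \<Rightarrow> real" and T b :: real
  assumes T: "0 < T" and m: "continuous_on {0..T} m" and b: "b \<noteq> 0"
  obtains T' d1 where "0 < T'" "T' \<le> T" "d1 0 = b"
    "\<And>t. t \<in> {0..T'} \<Longrightarrow> (d1 has_real_derivative m t * d1 t ^ 3) (at t within {0..T'})"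
    "\<And>t. t \<in> {0..T'} \<Longrightarrow> d1 t \<noteq> 0"
proof -
  define u where "u t = 1 / b\<^sup>2 - 2 * integral {0..t} m" for t
  have u': "(u has_real_derivative - 2 * m t) (at t within {0..T})" if "t \<in> {0..T}" for t
    unfolding u_def
    using integral_has_vector_derivative[OF m that]
    by (auto intro!: derivative_eq_intros simp: has_real_derivative_iff_has_vector_derivative[symmetric])
  have "continuous_on {0..T} u"
    using u' by (meson DERIV_continuous continuous_on_eq_continuous_within)
  moreover have u0: "u 0 = 1 / b\<^sup>2" "0 < u 0" using b by (auto simp: u_def)
  ultimately obtain \<delta> where \<delta>: "\<delta> > 0" "\<And>t. t \<in> {0..T} \<Longrightarrow> dist t 0 < \<delta> \<Longrightarrow> dist (u t) (u 0) < u 0"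
    unfolding continuous_on_iff using T by (metis atLeastAtMost_iff less_imp_le order_refl)
  define T' where "T' = min T (\<delta> / 2)"
  have T': "0 < T'" "T' \<le> T" using \<delta> T by (auto simp: T'_def)
  have pos: "0 < u t" if "t \<in> {0..T'}" for t
    using \<delta>(2)[of t] \<delta>(1) that by (auto simp: dist_real_def T'_def)
  \<comment> \<open>The square root loses the sign of the solution; \<open>sgn b\<close> restores
    it.\<close>
  define d1 where "d1 t = sgn b / sqrt (u t)" for t
  have ne: "d1 t \<noteq> 0" if "t \<in> {0..T'}" for t using pos[OF that] b by (simp add: d1_def sgn_eq_0_iff)
  have sb: "sgn b ^ 3 = sgn b" using b by (simp add: sgn_if power3_eq_cube)
  have "(d1 has_real_derivative m t * d1 t ^ 3) (at t within {0..T'})" if t: "t \<in> {0..T'}" for t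
  proof -
    let ?S = "sqrt (u t)"
    have S: "?S > 0" using pos[OF t] by simp
    have "(u has_real_derivative - 2 * m t) (at t within {0..T'})"
      by (rule DERIV_subset[OF u']) (use t T' in auto)
    then have "((\<lambda>t. sqrt (u t)) has_real_derivative (inverse ?S / 2) * (- 2 * m t)) (at t within {0..T'})"
      by (rule DERIV_chain'[where f = u and g = sqrt, OF _ DERIV_real_sqrt[OF pos[OF t]]])
    from DERIV_divide[OF DERIV_const[of "sgn b"] this] S
    have "(d1 has_real_derivative (0 * ?S - sgn b * ((inverse ?S / 2) * (- 2 * m t))) / (?S * ?S)) (at t within {0..T'})"
      by (simp add: d1_def[abs_def])
    moreover have "(0 * ?S - sgn b * ((inverse ?S / 2) * (- 2 * m t))) / (?S * ?S) = m t * d1 t ^ 3"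
      using S sb by (simp add: d1_def power_divide) (simp add: power3_eq_cube divide_simps)
    ultimately show ?thesis by simp
  qed
  moreover have "d1 0 = b"
    using b by (simp add: d1_def u0(1) real_sqrt_divide sgn_if)
  ultimately show ?thesis using that T' ne by blast
qed

theorem theorem4p7:
  fixes l :: "real \<Rightarrow> real option" and T a :: real
  assumes "T > 0"
    and "ext_continuous_on {0..T} l"
    and "l 0 \<noteq> Some 0"
    and "a \<noteq> 0"
  shows "\<exists>\<tau>>0. \<tau> \<le> T \<and>
           (\<exists>\<gamma> lam lam1 lam2. loewner_generated lam \<gamma> \<tau> \<and> C2_derivs lam lam1 lam2 \<tau> \<and>
              (\<forall>t\<in>{0<..<\<tau>}. loewner_curvature_val (lam1 t) (lam2 t) = l t) \<and>
              lam1 0 \<noteq> 0 \<and> 2 / 3 * lam1 0 = a)"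
proof -
  obtain T1 where T1: "0 < T1" "T1 \<le> T" "continuous_on {0..T1} (\<lambda>t. ext_inverse (l t))"
    "\<And>t. t \<in> {0..T1} \<Longrightarrow> l t \<noteq> Some 0"
    using ext_inverse_continuous[OF assms(1-3)] by metis
  \<comment> \<open>The scale is 2/3 of the initial slope, hence the initial value
    \<open>3 * a / 2\<close>.\<close>
  have "3 * a / 2 \<noteq> 0" using assms(4) by simp
  then obtain T2 d1 where T2: "0 < T2" "T2 \<le> T1" and d1: "d1 0 = 3 * a / 2"
    "\<And>t. t \<in> {0..T2} \<Longrightarrow> (d1 has_real_derivative ext_inverse (l t) * d1 t ^ 3) (at t within {0..T2})"
    "\<And>t. t \<in> {0..T2} \<Longrightarrow> d1 t \<noteq> 0"
    using curvature_ode[OF T1(1,3)] by metis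
  \<comment> \<open>\<open>d0\<close>, \<open>d1\<close>, \<open>d2\<close> serve as the driver and
    its first two derivatives; starting the integral at 0 gives \<open>d0 0 = 0\<close>.\<close>
  define d2 where "d2 t = ext_inverse (l t) * d1 t ^ 3" for t
  define d0 where "d0 t = integral {0..t} d1" for t
  have d1_cont: "continuous_on {0..T2} d1"
    using d1(2) by (meson DERIV_continuous continuous_on_eq_continuous_within)
  have d2_cont: "continuous_on {0..T2} d2"
    unfolding d2_def by (intro continuous_intros d1_cont continuous_on_subset[OF T1(3)]) (use T2 in auto)
  have d0': "(d0 has_real_derivative d1 t) (at t within {0..T2})" if "t \<in> {0..T2}" for t
    unfolding d0_def has_real_derivative_iff_has_vector_derivative
    by (rule integral_has_vector_derivative[OF d1_cont that])
  have "bounded (d1 ` {0..T2})"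
    by (intro compact_imp_bounded compact_continuous_image d1_cont) simp
  then obtain M where M: "0 < M" "\<And>t. t \<in> {0..T2} \<Longrightarrow> \<bar>d1 t\<bar> \<le> M"
    unfolding bounded_pos by auto
  \<comment> \<open>The bound \<open>1 / M^2\<close> is the short-time condition under which the
    driver generates a simple curve.\<close>
  define \<tau> where "\<tau> = min T2 (1 / M\<^sup>2)"
  have \<tau>: "0 < \<tau>" "\<tau> \<le> T2" "M\<^sup>2 * \<tau> \<le> 1"
    using T2 M(1) by (auto simp: \<tau>_def min_def field_simps)
  have sub: "{0..<\<tau>} \<subseteq> {0..T2}" using \<tau> by auto
  interpret slow_driver d0 d1 \<tau> M
    by standard (use \<tau> M(2) sub in \<open>auto intro: DERIV_subset[OF d0'] simp: d0_def\<close>)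
  have "C2_derivs d0 d1 d2 \<tau>"
    unfolding C2_derivs_def
    using sub DERIV_subset[OF d0' sub] DERIV_subset[OF d1(2) sub] continuous_on_subset[OF d2_cont sub]
    by (auto simp: d2_def)
  moreover have "\<forall>t\<in>{0<..<\<tau>}. loewner_curvature_val (d1 t) (d2 t) = l t"
    unfolding d2_def using d1(3) T1(4) \<tau> T2 by (intro ballI loewner_curvature_val_inverse) auto
  moreover have "d1 0 \<noteq> 0" "2 / 3 * d1 0 = a" using d1(1) assms(4) by auto
  moreover have "\<tau> \<le> T" using \<tau> T2 T1 by simp
  ultimately show ?thesis using generated \<tau>(1) by blast
qed

end
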